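(* Let $R$ be an associative ring with unit and $M$ a left unital $R$-module, and let $\mathcal{L}(M)$ be the lattice of submodules of $M$. The following statements are equivalent: (a) $M$ has finite hollow dimension. (b) There exist an $n \in \mathbb{N}$ and a mapping $d: \mathcal{L}(M) \to \{0, 1, \ldots, n\}$ such that for all $N, L \in \mathcal{L}(M)$: (i) if $d(N) = 0$, then $N = M$; (ii) if $N + L = M$, then $d(N \cap L) = d(N) + d(L)$. (c) There exists a partial ordering $(\mathcal{L}(M), \leq)$ on the set $\mathcal{L}(M)$ such that: (i) $(\mathcal{L}(M), \leq)$ is an artinian poset; (ii) for all $N, L \in \mathcal{L}(M)$ with $N + L = M$: if $L \neq M$, then $N > N \cap L$.
   Context: A submodule $N$ of $M$ is small, $N \ll M$, if $N + L \neq M$ for every proper submodule $L$ of $M$. A module is hollow if it is nonzero and every proper submodule is small in it. $M$ has finite hollow dimension (finite dual Goldie dimension) if there is an epimorphism $g: M \to \bigoplus_{i=1}^n H_i$ for some integer $n \geq 0$ with all $H_i$ hollow and $\mathrm{Ker}(g) \ll M$ (so the zero module has finite hollow dimension, with $n=0$). A poset is artinian if it satisfies the descending chain condition. The partial ordering in (c) is an arbitrary partial ordering on the set of submodules, not necessarily inclusion. *)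

theory Defs
  imports "HOL-Algebra.Module" "HOL-Algebra.AbelCoset" "HOL-Library.FuncSet"
begin

text \<open>
  The library locale \<^locale>\<open>module\<close> requires a commutative ring of scalars; the following is the
  same list of axioms over an arbitrary associative ring with unit.
  The library predicate \<^const>\<open>submodule\<close> does not depend on commutativity.
\<close>

locale left_module = R?: ring R + M?: abelian_group M
  for R :: "('r, 's) ring_scheme" (structure)
  and M :: "('r, 'm, 't) module_scheme" (structure) +
  assumes smult_closed [simp, intro]:
      "\<lbrakk>a \<in> carrier R; x \<in> carrier M\<rbrakk> \<Longrightarrow> a \<odot>\<^bsub>M\<^esub> x \<in> carrier M"
    and smult_l_distr:
      "\<lbrakk>a \<in> carrier R; b \<in> carrier R; x \<in> carrier M\<rbrakk> \<Longrightarrow>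
        (a \<oplus>\<^bsub>R\<^esub> b) \<odot>\<^bsub>M\<^esub> x = a \<odot>\<^bsub>M\<^esub> x \<oplus>\<^bsub>M\<^esub> b \<odot>\<^bsub>M\<^esub> x"
    and smult_r_distr:
      "\<lbrakk>a \<in> carrier R; x \<in> carrier M; y \<in> carrier M\<rbrakk> \<Longrightarrow>
        a \<odot>\<^bsub>M\<^esub> (x \<oplus>\<^bsub>M\<^esub> y) = a \<odot>\<^bsub>M\<^esub> x \<oplus>\<^bsub>M\<^esub> a \<odot>\<^bsub>M\<^esub> y"
    and smult_assoc1:
      "\<lbrakk>a \<in> carrier R; b \<in> carrier R; x \<in> carrier M\<rbrakk> \<Longrightarrow>
        (a \<otimes>\<^bsub>R\<^esub> b) \<odot>\<^bsub>M\<^esub> x = a \<odot>\<^bsub>M\<^esub> (b \<odot>\<^bsub>M\<^esub> x)"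
    and smult_one [simp]:
      "x \<in> carrier M \<Longrightarrow> \<one>\<^bsub>R\<^esub> \<odot>\<^bsub>M\<^esub> x = x"

lemma module_imp_left_module: "module R M \<Longrightarrow> left_module R M"
  unfolding module_def left_module_def module_axioms_def left_module_axioms_def
  by (simp add: cring.axioms(1))

definition submodules ::
    "('r, 's) ring_scheme \<Rightarrow> ('r, 'm, 't) module_scheme \<Rightarrow> 'm set set" where
  "submodules R M = {N. submodule N R M}"

definition left_module_hom ::
    "('r, 's) ring_scheme \<Rightarrow> ('r, 'm, 't) module_scheme \<Rightarrow> ('r, 'h, 'u) module_scheme
      \<Rightarrow> ('m \<Rightarrow> 'h) set" where
  "left_module_hom R M N =
    {f \<in> hom (add_monoid M) (add_monoid N).
      \<forall>a \<in> carrier R. \<forall>x \<in> carrier M. f (a \<odot>\<^bsub>M\<^esub> x) = a \<odot>\<^bsub>N\<^esub> f x}"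

definition small_submodule ::
    "('r, 's) ring_scheme \<Rightarrow> ('r, 'm, 't) module_scheme \<Rightarrow> 'm set \<Rightarrow> bool" where
  "small_submodule R M N \<longleftrightarrow>
    N \<in> submodules R M \<and>
    (\<forall>L \<in> submodules R M. L \<noteq> carrier M \<longrightarrow> N <+>\<^bsub>M\<^esub> L \<noteq> carrier M)"

definition hollow_module ::
    "('r, 's) ring_scheme \<Rightarrow> ('r, 'm, 't) module_scheme \<Rightarrow> bool" where
  "hollow_module R M \<longleftrightarrow>
    left_module R M \<and> carrier M \<noteq> {\<zero>\<^bsub>M\<^esub>} \<and>
    (\<forall>N \<in> submodules R M. N \<noteq> carrier M \<longrightarrow> small_submodule R M N)"

text \<open>
  The multiplicative part of a module record carries no meaning and is left unspecified.
  For the empty index set the carrier is a singleton, i.e. the sum is the zero module.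
\<close>

definition direct_sum ::
    "'i set \<Rightarrow> ('i \<Rightarrow> ('r, 'h, 'u) module_scheme) \<Rightarrow> ('r, 'i \<Rightarrow> 'h) module" where
  "direct_sum I H =
    \<lparr>carrier = {x \<in> \<Pi>\<^sub>E i\<in>I. carrier (H i). finite {i \<in> I. x i \<noteq> \<zero>\<^bsub>H i\<^esub>}},
     mult = undefined,
     one = undefined,
     zero = (\<lambda>i\<in>I. \<zero>\<^bsub>H i\<^esub>),
     add = (\<lambda>x y. \<lambda>i\<in>I. x i \<oplus>\<^bsub>H i\<^esub> y i),
     smult = (\<lambda>a x. \<lambda>i\<in>I. a \<odot>\<^bsub>H i\<^esub> x i)\<rparr>"

text \<open>
  \<open>g\<close> is an epimorphism with small kernel from \<open>M\<close> onto the direct sum of the hollow modules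
  \<open>H 0, \<dots>, H (n - 1)\<close>.
\<close>

definition hollow_cover ::
    "('r, 's) ring_scheme \<Rightarrow> ('r, 'm, 't) module_scheme \<Rightarrow> nat
      \<Rightarrow> (nat \<Rightarrow> ('r, 'h, 'u) module_scheme) \<Rightarrow> ('m \<Rightarrow> nat \<Rightarrow> 'h) \<Rightarrow> bool" where
  "hollow_cover R M n H g \<longleftrightarrow>
    (\<forall>i<n. hollow_module R (H i)) \<and>
    g \<in> left_module_hom R M (direct_sum {..<n} H) \<and>
    g ` carrier M = carrier (direct_sum {..<n} H) \<and>
    small_submodule R M (a_kernel M (direct_sum {..<n} H) g)"

text \<open>
  HOL cannot quantify over the carrier types of the summands inside a definition. The type
  \<open>'m set\<close> loses nothing: each summand is a homomorphic image of \<open>M\<close>, hence isomorphic to a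
  quotient of \<open>M\<close>, whose elements are cosets. See \<open>has_finite_hollow_dimensionI\<close> below.
\<close>

definition has_finite_hollow_dimension ::
    "('r, 's) ring_scheme \<Rightarrow> ('r, 'm, 't) module_scheme \<Rightarrow> bool" where
  "has_finite_hollow_dimension R M \<longleftrightarrow>
    (\<exists>(n::nat) (H :: nat \<Rightarrow> ('r, 'm set) module) g. hollow_cover R M n H g)"

text \<open>The descending chain condition: every descending sequence becomes stationary.\<close>

definition artinian_poset :: "'a set \<Rightarrow> 'a rel \<Rightarrow> bool" where
  "artinian_poset A r \<longleftrightarrow>
    partial_order_on A r \<and>
    (\<forall>f :: nat \<Rightarrow> 'a. (\<forall>i. f i \<in> A) \<and> (\<forall>i. (f (Suc i), f i) \<in> r)
      \<longrightarrow> (\<exists>k. \<forall>i\<ge>k. f i = f k))"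


subsection \<open>Independence of the carrier type of the summands\<close>

definition transport ::
    "('h \<Rightarrow> 'k) \<Rightarrow> ('r, 'h, 'u) module_scheme \<Rightarrow> ('r, 'k) module" where
  "transport \<phi> N =
    (let \<psi> = inv_into (carrier N) \<phi> in
    \<lparr>carrier = \<phi> ` carrier N,
     mult = undefined,
     one = undefined,
     zero = \<phi> \<zero>\<^bsub>N\<^esub>,
     add = (\<lambda>x y. \<phi> (\<psi> x \<oplus>\<^bsub>N\<^esub> \<psi> y)),
     smult = (\<lambda>a x. \<phi> (a \<odot>\<^bsub>N\<^esub> \<psi> x))\<rparr>)"

lemma transport_simps:
  assumes "inj_on \<phi> (carrier N)"
  shows "carrier (transport \<phi> N) = \<phi> ` carrier N"
    and "\<zero>\<^bsub>transport \<phi> N\<^esub> = \<phi> \<zero>\<^bsub>N\<^esub>"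
    and "\<lbrakk>x \<in> carrier N; y \<in> carrier N\<rbrakk>
      \<Longrightarrow> \<phi> x \<oplus>\<^bsub>transport \<phi> N\<^esub> \<phi> y = \<phi> (x \<oplus>\<^bsub>N\<^esub> y)"
    and "x \<in> carrier N \<Longrightarrow> a \<odot>\<^bsub>transport \<phi> N\<^esub> \<phi> x = \<phi> (a \<odot>\<^bsub>N\<^esub> x)"
  using assms by (simp_all add: transport_def Let_def)

lemma left_module_transport:
  assumes "left_module R N" and inj: "inj_on \<phi> (carrier N)"
  shows "left_module R (transport \<phi> N)"
proof -
  interpret N: left_module R N by fact
  note [simp] = transport_simps[OF inj]
  have "abelian_group (transport \<phi> N)"
  proof (rule abelian_groupI)
    fix x assume "x \<in> carrier (transport \<phi> N)"
    then obtain x' where x': "x' \<in> carrier N" "x = \<phi> x'" by auto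
    then show "\<exists>y\<in>carrier (transport \<phi> N). y \<oplus>\<^bsub>transport \<phi> N\<^esub> x = \<zero>\<^bsub>transport \<phi> N\<^esub>"
      by (intro bexI[of _ "\<phi> (\<ominus>\<^bsub>N\<^esub> x')"]) (auto simp: N.l_neg)
  qed (auto simp: N.a_assoc N.a_comm N.a_lcomm)
  then show ?thesis
    by (intro left_module.intro left_module_axioms.intro N.R.ring_axioms)
      (auto simp: N.smult_l_distr N.smult_r_distr N.smult_assoc1)
qed

lemma (in left_module) submodule_iff:
  "N \<in> submodules R M \<longleftrightarrow>
    N \<subseteq> carrier M \<and> \<zero>\<^bsub>M\<^esub> \<in> N \<and> (\<forall>x\<in>N. \<forall>y\<in>N. x \<oplus>\<^bsub>M\<^esub> y \<in> N) \<and>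
    (\<forall>a\<in>carrier R. \<forall>x\<in>N. a \<odot>\<^bsub>M\<^esub> x \<in> N)" (is "?L \<longleftrightarrow> ?R")
proof
  assume ?L
  then have sub: "subgroup N (add_monoid M)"
    and sm: "\<And>a x. a \<in> carrier R \<Longrightarrow> x \<in> N \<Longrightarrow> a \<odot>\<^bsub>M\<^esub> x \<in> N"
    by (simp_all add: submodules_def submodule_def submodule_axioms_def)
  show ?R
    using subgroup.subset[OF sub] subgroup.one_closed[OF sub] subgroup.m_closed[OF sub] sm
    by simp
next
  assume r: ?R
  have "inv\<^bsub>add_monoid M\<^esub> x \<in> N" if x: "x \<in> N" for x
  proof -
    have xc: "x \<in> carrier M" using r x by auto
    have "(\<ominus>\<^bsub>R\<^esub> \<one>\<^bsub>R\<^esub>) \<odot>\<^bsub>M\<^esub> x \<oplus>\<^bsub>M\<^esub> x = (\<ominus>\<^bsub>R\<^esub> \<one>\<^bsub>R\<^esub> \<oplus>\<^bsub>R\<^esub> \<one>\<^bsub>R\<^esub>) \<odot>\<^bsub>M\<^esub> x"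
      using xc by (simp add: smult_l_distr)
    also have "\<dots> = \<zero>\<^bsub>R\<^esub> \<odot>\<^bsub>M\<^esub> x" by (simp add: R.l_neg)
    also have "\<dots> = \<zero>\<^bsub>M\<^esub>"
      using smult_l_distr[of "\<zero>\<^bsub>R\<^esub>" "\<zero>\<^bsub>R\<^esub>" x] xc by (simp add: M.add.r_cancel_one')
    finally have "(\<ominus>\<^bsub>R\<^esub> \<one>\<^bsub>R\<^esub>) \<odot>\<^bsub>M\<^esub> x = \<ominus>\<^bsub>M\<^esub> x"
      using xc by (simp add: M.minus_equality)
    then show ?thesis using r x by (metis R.a_inv_closed R.one_closed a_inv_def)
  qed
  moreover have "N \<subseteq> carrier M" "\<zero>\<^bsub>M\<^esub> \<in> N" "\<And>x y. x \<in> N \<Longrightarrow> y \<in> N \<Longrightarrow> x \<oplus>\<^bsub>M\<^esub> y \<in> N"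
    and sm: "\<forall>a\<in>carrier R. \<forall>x\<in>N. a \<odot>\<^bsub>M\<^esub> x \<in> N"
    using r by blast+
  ultimately have "subgroup N (add_monoid M)"
    by (intro subgroup.intro) simp_all
  then show ?L
    using sm by (simp add: submodules_def submodule_def submodule_axioms_def)
qed

lemma hollow_module_transport:
  assumes hol: "hollow_module R N" and inj: "inj_on \<phi> (carrier N)"
  shows "hollow_module R (transport \<phi> N)"
proof -
  interpret N: left_module R N using hol by (simp add: hollow_module_def)
  let ?T = "transport \<phi> N"
  interpret T: left_module R ?T using N.left_module_axioms inj by (rule left_module_transport)
  note [simp] = transport_simps[OF inj]
  have pre: "\<exists>L' \<in> submodules R N. L = \<phi> ` L'" if "L \<in> submodules R ?T" for L
  proof
    let ?L' = "{x \<in> carrier N. \<phi> x \<in> L}"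
    have L: "L \<subseteq> \<phi> ` carrier N" "\<phi> \<zero>\<^bsub>N\<^esub> \<in> L"
        "\<And>x y. x \<in> L \<Longrightarrow> y \<in> L \<Longrightarrow> x \<oplus>\<^bsub>?T\<^esub> y \<in> L"
        "\<And>a x. a \<in> carrier R \<Longrightarrow> x \<in> L \<Longrightarrow> a \<odot>\<^bsub>?T\<^esub> x \<in> L"
      using that by (auto simp: T.submodule_iff)
    show "L = \<phi> ` ?L'" using L(1) by auto
    show "?L' \<in> submodules R N"
    proof -
      have "\<phi> (x \<oplus>\<^bsub>N\<^esub> y) \<in> L" if "x \<in> ?L'" "y \<in> ?L'" for x y
        using that L(3)[of "\<phi> x" "\<phi> y"] by simp
      moreover have "\<phi> (a \<odot>\<^bsub>N\<^esub> x) \<in> L" if "a \<in> carrier R" "x \<in> ?L'" for a x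
        using that L(4)[of a "\<phi> x"] by simp
      ultimately show ?thesis unfolding N.submodule_iff using L(2) by auto
    qed
  qed
  have sum: "\<phi> ` K <+>\<^bsub>?T\<^esub> \<phi> ` L = \<phi> ` (K <+>\<^bsub>N\<^esub> L)"
    if "K \<subseteq> carrier N" "L \<subseteq> carrier N" for K L
  proof -
    have "\<phi> x \<oplus>\<^bsub>?T\<^esub> \<phi> y = \<phi> (x \<oplus>\<^bsub>N\<^esub> y)" if "x \<in> K" "y \<in> L" for x y
      using that \<open>K \<subseteq> _\<close> \<open>L \<subseteq> _\<close> transport_simps(3)[OF inj] by blast
    then show ?thesis
      unfolding set_add_def set_mult_def by auto
  qed
  have sub: "L \<subseteq> carrier N" if "L \<in> submodules R N" for L
    using that by (simp add: N.submodule_iff)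
  have "small_submodule R ?T K" if K: "K \<in> submodules R ?T" "K \<noteq> carrier ?T" for K
    unfolding small_submodule_def
  proof (intro conjI ballI impI)
    fix L assume L: "L \<in> submodules R ?T" "L \<noteq> carrier ?T"
    obtain K' L' where *: "K' \<in> submodules R N" "K = \<phi> ` K'" "L' \<in> submodules R N" "L = \<phi> ` L'"
      using pre K L by metis
    have "K' \<noteq> carrier N" "L' \<noteq> carrier N" using * K L by auto
    then have "K' <+>\<^bsub>N\<^esub> L' \<noteq> carrier N"
      using hol * by (auto simp: hollow_module_def small_submodule_def)
    moreover have "K' <+>\<^bsub>N\<^esub> L' \<subseteq> carrier N"
      using sub[OF *(1)] sub[OF *(3)] by (auto simp: set_add_def set_mult_def)
    ultimately have "\<phi> ` (K' <+>\<^bsub>N\<^esub> L') \<noteq> \<phi> ` carrier N"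
      using inj by (simp add: inj_on_image_eq_iff)
    then show "K <+>\<^bsub>?T\<^esub> L \<noteq> carrier ?T"
      using * sum sub by simp
  qed (use K in simp)
  moreover have "carrier ?T \<noteq> {\<zero>\<^bsub>?T\<^esub>}"
  proof -
    obtain x where "x \<in> carrier N" "x \<noteq> \<zero>\<^bsub>N\<^esub>"
      using hol N.zero_closed unfolding hollow_module_def by blast
    then have "\<phi> x \<in> \<phi> ` carrier N" "\<phi> x \<noteq> \<phi> \<zero>\<^bsub>N\<^esub>"
      using inj by (auto dest: inj_onD)
    then show ?thesis by auto
  qed
  ultimately show ?thesis
    using T.left_module_axioms unfolding hollow_module_def by blast
qed

lemma direct_sum_simps:
  assumes "finite I"
  shows "carrier (direct_sum I H) = (\<Pi>\<^sub>E i\<in>I. carrier (H i))"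
    and "\<zero>\<^bsub>direct_sum I H\<^esub> = (\<lambda>i\<in>I. \<zero>\<^bsub>H i\<^esub>)"
    and "x \<oplus>\<^bsub>direct_sum I H\<^esub> y = (\<lambda>i\<in>I. x i \<oplus>\<^bsub>H i\<^esub> y i)"
    and "a \<odot>\<^bsub>direct_sum I H\<^esub> x = (\<lambda>i\<in>I. a \<odot>\<^bsub>H i\<^esub> x i)"
  using assms by (auto simp: direct_sum_def)

theorem has_finite_hollow_dimensionI:
  fixes H :: "nat \<Rightarrow> ('r, 'h, 'u) module_scheme"
    and M :: "('r, 'm, 't) module_scheme"
  assumes cover: "hollow_cover R M n H g"
  shows "has_finite_hollow_dimension R M"
proof -
  let ?D = "direct_sum {..<n} H"
  have hol: "\<And>i. i < n \<Longrightarrow> hollow_module R (H i)"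
    and hom: "g \<in> left_module_hom R M ?D"
    and surj: "g ` carrier M = (\<Pi>\<^sub>E i\<in>{..<n}. carrier (H i))"
    and ker: "small_submodule R M (a_kernel M ?D g)"
    using cover by (auto simp: hollow_cover_def direct_sum_simps)
  have mod: "left_module R (H i)" if "i < n" for i
    using hol[OF that] by (simp add: hollow_module_def)
  have zero_mem: "\<zero>\<^bsub>H i\<^esub> \<in> carrier (H i)" if "i < n" for i
    using mod[OF that] by (simp add: left_module_def abelian_group_def abelian_monoid.zero_closed)
  define \<phi> where "\<phi> i y = {x \<in> carrier M. g x i = y}" for i y
  have inj: "inj_on (\<phi> i) (carrier (H i))" if i: "i < n" for i
  proof (rule inj_onI)
    fix y z assume y: "y \<in> carrier (H i)" and eq: "\<phi> i y = \<phi> i z"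
    let ?f = "\<lambda>j\<in>{..<n}. if j = i then y else \<zero>\<^bsub>H j\<^esub>"
    have "?f \<in> (\<Pi>\<^sub>E i\<in>{..<n}. carrier (H i))"
      using y zero_mem by auto
    then have "?f \<in> g ` carrier M" by (simp only: surj)
    then obtain x where x: "x \<in> carrier M" "g x = ?f" by (elim imageE) simp
    have "x \<in> \<phi> i y" using i x by (simp add: \<phi>_def)
    then show "y = z" using eq by (auto simp: \<phi>_def)
  qed
  define H' where "H' i = transport (\<phi> i) (H i)" for i
  define \<Phi> where "\<Phi> f = (\<lambda>i\<in>{..<n}. \<phi> i (f i))" for f
  let ?D' = "direct_sum {..<n} H'"
  have hol': "hollow_module R (H' i)" if "i < n" for i
    unfolding H'_def using hol[OF that] inj[OF that] by (rule hollow_module_transport)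
  have H': "carrier (H' i) = \<phi> i ` carrier (H i)" "\<zero>\<^bsub>H' i\<^esub> = \<phi> i \<zero>\<^bsub>H i\<^esub>"
    "\<And>x y. x \<in> carrier (H i) \<Longrightarrow> y \<in> carrier (H i) \<Longrightarrow> \<phi> i x \<oplus>\<^bsub>H' i\<^esub> \<phi> i y = \<phi> i (x \<oplus>\<^bsub>H i\<^esub> y)"
    "\<And>a x. x \<in> carrier (H i) \<Longrightarrow> a \<odot>\<^bsub>H' i\<^esub> \<phi> i x = \<phi> i (a \<odot>\<^bsub>H i\<^esub> x)" if "i < n" for i
    unfolding H'_def by (fact transport_simps[OF inj[OF that]])+
  have gi: "g x i \<in> carrier (H i)" if "x \<in> carrier M" "i < n" for x i
    using surj that by auto
  have gE: "g x \<in> extensional {..<n}" if "x \<in> carrier M" for x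
    using surj that by (auto simp: PiE_def)
  have g_add: "g (x \<oplus>\<^bsub>M\<^esub> y) = (\<lambda>i\<in>{..<n}. g x i \<oplus>\<^bsub>H i\<^esub> g y i)"
    if "x \<in> carrier M" "y \<in> carrier M" for x y
    using hom that by (simp add: left_module_hom_def hom_def direct_sum_simps)
  have g_smult: "g (a \<odot>\<^bsub>M\<^esub> x) = (\<lambda>i\<in>{..<n}. a \<odot>\<^bsub>H i\<^esub> g x i)"
    if "a \<in> carrier R" "x \<in> carrier M" for a x
    using hom that by (simp add: left_module_hom_def direct_sum_simps)
  have hom': "\<Phi> \<circ> g \<in> left_module_hom R M ?D'"
    unfolding left_module_hom_def hom_def
    by (auto simp: direct_sum_simps \<Phi>_def H' gi g_add g_smult intro!: restrict_ext)
  have surj': "(\<Phi> \<circ> g) ` carrier M = carrier ?D'"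
  proof
    show "(\<Phi> \<circ> g) ` carrier M \<subseteq> carrier ?D'"
      by (auto simp: direct_sum_simps \<Phi>_def H' gi)
    show "carrier ?D' \<subseteq> (\<Phi> \<circ> g) ` carrier M"
    proof
      fix f assume "f \<in> carrier ?D'"
      then have f: "f \<in> (\<Pi>\<^sub>E i\<in>{..<n}. \<phi> i ` carrier (H i))"
        by (auto simp: direct_sum_simps PiE_iff H')
      then have "\<forall>i\<in>{..<n}. \<exists>y. y \<in> carrier (H i) \<and> f i = \<phi> i y" by (auto simp: PiE_iff)
      then obtain k where k: "\<forall>i\<in>{..<n}. k i \<in> carrier (H i) \<and> f i = \<phi> i (k i)" by metis
      then have "restrict k {..<n} \<in> g ` carrier M" unfolding surj by auto
      then obtain x where x: "x \<in> carrier M" "g x = restrict k {..<n}" by auto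
      have "f = (\<Phi> \<circ> g) x"
        using f k x by (intro ext) (simp add: \<Phi>_def PiE_iff extensional_def restrict_def)
      then show "f \<in> (\<Phi> \<circ> g) ` carrier M" using x(1) by (rule image_eqI)
    qed
  qed
  have "\<Phi> (g x) = \<zero>\<^bsub>?D'\<^esub> \<longleftrightarrow> g x = \<zero>\<^bsub>?D\<^esub>" if x: "x \<in> carrier M" for x
  proof
    assume a: "\<Phi> (g x) = \<zero>\<^bsub>?D'\<^esub>"
    have "g x i = \<zero>\<^bsub>H i\<^esub>" if i: "i < n" for i
    proof -
      have "\<phi> i (g x i) = \<phi> i \<zero>\<^bsub>H i\<^esub>"
        using fun_cong[OF a, of i] i by (simp add: \<Phi>_def direct_sum_simps H')
      then show ?thesis
        using inj[OF i] gi[OF x i] zero_mem[OF i] by (auto dest: inj_onD)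
    qed
    then show "g x = \<zero>\<^bsub>?D\<^esub>"
      using gE[OF x] by (auto simp: direct_sum_simps extensional_def)
  next
    assume "g x = \<zero>\<^bsub>?D\<^esub>"
    then show "\<Phi> (g x) = \<zero>\<^bsub>?D'\<^esub>"
      by (auto simp: \<Phi>_def direct_sum_simps H' intro!: restrict_ext)
  qed
  then have "a_kernel M ?D' (\<Phi> \<circ> g) = a_kernel M ?D g"
    by (auto simp: a_kernel_def kernel_def)
  then have "hollow_cover R M n H' (\<Phi> \<circ> g)"
    using hol' hom' surj' ker by (simp add: hollow_cover_def)
  then show ?thesis
    unfolding has_finite_hollow_dimension_def by blast
qed

end

theory Submission
  imports Defs
begin

text \<open>
  Everything is expressed in the modular lattice of submodules, where the theory is the order dual
  of the theory of uniform dimension. Comaximality replaces independence, and submodules \<open>H\<close> with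
  \<open>M/H\<close> hollow replace uniform submodules. A hollow basis over \<open>N\<close> is a finite coindependent
  family of such submodules above \<open>N\<close> whose intersection is small modulo \<open>N\<close>. By the Chinese
  remainder theorem, condition (a) says that the zero submodule has a hollow basis
  (\<open>hollow_basis_if_hollow_cover\<close>, \<open>has_finite_hollow_dimension_if_hollow_basis\<close>).

  The three conditions meet in the well-foundedness of the relation \<open>cosplit\<close>, which descends from
  \<open>A\<close> to \<open>A \<inter> L\<close> whenever \<open>A + L = M\<close> and \<open>L \<noteq> M\<close>. Condition (c) demands an artinian ordering
  that contains these descents. A function \<open>d\<close> as in (b) strictly increases along them and is
  bounded. A hollow basis \<open>H\<close> of the zero submodule gives well-foundedness by a counting argument:
  consider the largest number of members of \<open>H\<close> whose intersection is comaximal to \<open>A\<close>. If this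
  number were the same for \<open>A\<close> and \<open>A \<inter> L\<close>, an optimal choice for \<open>A \<inter> L\<close> with intersection \<open>C\<close>
  would be optimal for \<open>A\<close> too. Then \<open>A \<inter> C\<close> is comaximal to no member of \<open>H\<close>, which
  forces it to be small (\<open>small_over_if_not_comaximal\<close>); but it is comaximal to \<open>L \<noteq> M\<close>.

  Conversely, when \<open>cosplit\<close> is well-founded, every proper submodule lies below one with hollow
  quotient, and adding such submodules to a coindependent family must stop, so that every \<open>N\<close> has a
  hollow basis (\<open>ex_hollow_basis\<close>). This proves (a), and also provides the function of (b): let
  \<open>d N\<close> be the length of a hollow basis over \<open>N\<close>, that is, the hollow dimension of \<open>M/N\<close>. The same
  counting argument shows that \<open>d N\<close> does not depend on the basis and is largest for \<open>N = 0\<close>. If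
  \<open>N + L = M\<close>, then hollow bases over \<open>N\<close> and over \<open>L\<close> together form one over \<open>N \<inter> L\<close>
  (\<open>hollow_basis_append\<close>), whence additivity. Finally (c) follows from (b) by ordering submodules by
  decreasing \<open>d\<close>.
\<close>

section \<open>Comaximal submodules\<close>

context left_module
begin

abbreviation S where "S \<equiv> submodules R M"

definition comaximal :: "'m set \<Rightarrow> 'm set \<Rightarrow> bool" where
  "comaximal A B \<longleftrightarrow> A <+>\<^bsub>M\<^esub> B = carrier M"

lemma set_add_iff: "x \<in> A <+>\<^bsub>M\<^esub> B \<longleftrightarrow> (\<exists>a\<in>A. \<exists>b\<in>B. x = a \<oplus>\<^bsub>M\<^esub> b)"
  by (auto simp: set_add_def set_mult_def)

lemma submodule_carrier [simp]: "carrier M \<in> S"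
  by (simp add: submodule_iff)

lemma submodule_mem: "A \<in> S \<Longrightarrow> x \<in> A \<Longrightarrow> x \<in> carrier M"
  by (auto simp: submodule_iff)

lemma submodule_subset: "A \<in> S \<Longrightarrow> A \<subseteq> carrier M"
  by (auto simp: submodule_iff)

lemma submodule_zero: "A \<in> S \<Longrightarrow> \<zero>\<^bsub>M\<^esub> \<in> A"
  by (auto simp: submodule_iff)

lemma submodule_add: "A \<in> S \<Longrightarrow> x \<in> A \<Longrightarrow> y \<in> A \<Longrightarrow> x \<oplus>\<^bsub>M\<^esub> y \<in> A"
  by (auto simp: submodule_iff)

lemma submodule_smult: "A \<in> S \<Longrightarrow> a \<in> carrier R \<Longrightarrow> x \<in> A \<Longrightarrow> a \<odot>\<^bsub>M\<^esub> x \<in> A"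
  by (auto simp: submodule_iff)

lemma submodule_minus: "A \<in> S \<Longrightarrow> x \<in> A \<Longrightarrow> \<ominus>\<^bsub>M\<^esub> x \<in> A"
  using subgroup.m_inv_closed[of A "add_monoid M" x]
  by (auto simp: submodules_def submodule_def a_inv_def)

lemma submodule_diff: "A \<in> S \<Longrightarrow> x \<in> A \<Longrightarrow> y \<in> A \<Longrightarrow> x \<ominus>\<^bsub>M\<^esub> y \<in> A"
  by (simp add: a_minus_def submodule_add submodule_minus)

lemma submodule_Int [simp]: "A \<in> S \<Longrightarrow> B \<in> S \<Longrightarrow> A \<inter> B \<in> S"
  by (auto simp: submodule_iff)

lemma diff_zero: "x \<in> carrier M \<Longrightarrow> x \<ominus>\<^bsub>M\<^esub> \<zero>\<^bsub>M\<^esub> = x"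
  using M.minus_equality[of "\<zero>\<^bsub>M\<^esub>" "\<zero>\<^bsub>M\<^esub>"] by (simp add: M.minus_eq)

lemma diff_add_diff:
  "x \<in> carrier M \<Longrightarrow> y \<in> carrier M \<Longrightarrow> z \<in> carrier M
    \<Longrightarrow> (z \<ominus>\<^bsub>M\<^esub> x) \<oplus>\<^bsub>M\<^esub> (x \<ominus>\<^bsub>M\<^esub> y) = z \<ominus>\<^bsub>M\<^esub> y"
  by (simp add: M.minus_eq M.a_assoc M.r_neg1)

lemma minus_diff:
  "x \<in> carrier M \<Longrightarrow> y \<in> carrier M \<Longrightarrow> \<ominus>\<^bsub>M\<^esub> (x \<ominus>\<^bsub>M\<^esub> y) = y \<ominus>\<^bsub>M\<^esub> x"
  by (simp add: M.minus_eq M.minus_add M.a_comm)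

lemma smult_minus:
  assumes "a \<in> carrier R" "x \<in> carrier M"
  shows "a \<odot>\<^bsub>M\<^esub> (\<ominus>\<^bsub>M\<^esub> x) = \<ominus>\<^bsub>M\<^esub> (a \<odot>\<^bsub>M\<^esub> x)"
proof -
  have z: "a \<odot>\<^bsub>M\<^esub> \<zero>\<^bsub>M\<^esub> = \<zero>\<^bsub>M\<^esub>"
    using smult_r_distr[of a "\<zero>\<^bsub>M\<^esub>" "\<zero>\<^bsub>M\<^esub>"] assms by (simp add: M.add.r_cancel_one')
  have "a \<odot>\<^bsub>M\<^esub> (\<ominus>\<^bsub>M\<^esub> x) \<oplus>\<^bsub>M\<^esub> a \<odot>\<^bsub>M\<^esub> x = \<zero>\<^bsub>M\<^esub>"
    using assms by (simp add: smult_r_distr[symmetric] M.l_neg z)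
  then show ?thesis using assms by (simp add: M.minus_equality)
qed

lemma submodule_sum [simp]:
  assumes A: "A \<in> S" and B: "B \<in> S"
  shows "A <+>\<^bsub>M\<^esub> B \<in> S"
  unfolding submodule_iff
proof (intro conjI ballI)
  show "A <+>\<^bsub>M\<^esub> B \<subseteq> carrier M"
    using submodule_mem[OF A] submodule_mem[OF B] by (auto simp: set_add_iff)
  show "\<zero>\<^bsub>M\<^esub> \<in> A <+>\<^bsub>M\<^esub> B"
    unfolding set_add_iff
    by (rule bexI[OF _ submodule_zero[OF A]], rule bexI[OF _ submodule_zero[OF B]]) simp
next
  fix x y assume "x \<in> A <+>\<^bsub>M\<^esub> B" "y \<in> A <+>\<^bsub>M\<^esub> B"
  then obtain a b c d where *: "a \<in> A" "b \<in> B" "c \<in> A" "d \<in> B"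
    and xy: "x = a \<oplus>\<^bsub>M\<^esub> b" "y = c \<oplus>\<^bsub>M\<^esub> d"
    unfolding set_add_iff by blast
  have "x \<oplus>\<^bsub>M\<^esub> y = (a \<oplus>\<^bsub>M\<^esub> c) \<oplus>\<^bsub>M\<^esub> (b \<oplus>\<^bsub>M\<^esub> d)"
    using * submodule_mem[OF A] submodule_mem[OF B] by (simp add: xy M.a_ac)
  then show "x \<oplus>\<^bsub>M\<^esub> y \<in> A <+>\<^bsub>M\<^esub> B"
    unfolding set_add_iff using * submodule_add[OF A] submodule_add[OF B] by blast
next
  fix r x assume r: "r \<in> carrier R" and "x \<in> A <+>\<^bsub>M\<^esub> B"
  then obtain a b where *: "a \<in> A" "b \<in> B" and x: "x = a \<oplus>\<^bsub>M\<^esub> b"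
    unfolding set_add_iff by blast
  have "r \<odot>\<^bsub>M\<^esub> x = r \<odot>\<^bsub>M\<^esub> a \<oplus>\<^bsub>M\<^esub> r \<odot>\<^bsub>M\<^esub> b"
    using * r submodule_mem[OF A] submodule_mem[OF B] by (simp add: x smult_r_distr)
  then show "r \<odot>\<^bsub>M\<^esub> x \<in> A <+>\<^bsub>M\<^esub> B"
    unfolding set_add_iff using * r submodule_smult[OF A] submodule_smult[OF B] by blast
qed

lemma subset_sum_left: "A \<in> S \<Longrightarrow> B \<in> S \<Longrightarrow> A \<subseteq> A <+>\<^bsub>M\<^esub> B"
  using submodule_zero[of B] submodule_mem[of A] by (force simp: set_add_iff)

lemma subset_sum_right: "A \<in> S \<Longrightarrow> B \<in> S \<Longrightarrow> B \<subseteq> A <+>\<^bsub>M\<^esub> B"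
  using submodule_zero[of A] submodule_mem[of B] by (force simp: set_add_iff)

lemma sum_subset: "C \<in> S \<Longrightarrow> A \<subseteq> C \<Longrightarrow> B \<subseteq> C \<Longrightarrow> A <+>\<^bsub>M\<^esub> B \<subseteq> C"
  by (auto simp: set_add_iff intro!: submodule_add)

lemma comaximal_iff:
  assumes "A \<in> S" "B \<in> S"
  shows "comaximal A B \<longleftrightarrow> (\<forall>x\<in>carrier M. \<exists>a\<in>A. \<exists>b\<in>B. x = a \<oplus>\<^bsub>M\<^esub> b)"
proof -
  have "comaximal A B \<longleftrightarrow> (\<forall>x\<in>carrier M. x \<in> A <+>\<^bsub>M\<^esub> B)"
    using submodule_subset[OF submodule_sum[OF assms]] unfolding comaximal_def by blast
  then show ?thesis by (simp only: set_add_iff)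
qed

lemma comaximal_sym: "comaximal A B \<Longrightarrow> A \<in> S \<Longrightarrow> B \<in> S \<Longrightarrow> comaximal B A"
  unfolding comaximal_iff by (metis M.a_comm submodule_mem)

lemma comaximal_mono:
  "comaximal A B \<Longrightarrow> A \<subseteq> A' \<Longrightarrow> B \<subseteq> B' \<Longrightarrow> A \<in> S \<Longrightarrow> B \<in> S \<Longrightarrow> A' \<in> S \<Longrightarrow> B' \<in> S
    \<Longrightarrow> comaximal A' B'"
  unfolding comaximal_iff by (meson subsetD)

lemma comaximal_subset:
  "comaximal A B \<Longrightarrow> A \<subseteq> C \<Longrightarrow> B \<subseteq> C \<Longrightarrow> C \<in> S \<Longrightarrow> C = carrier M"
  unfolding comaximal_def using sum_subset[of C A B] submodule_subset[of C] by blast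

lemma comaximal_carrier: "A \<in> S \<Longrightarrow> comaximal A (carrier M)"
  unfolding comaximal_def
  using subset_sum_right[OF _ submodule_carrier] submodule_subset[OF submodule_sum[OF _ submodule_carrier]]
  by blast

text \<open>
  Coindependence of three submodules does not depend on their order. For \<open>x = a + b\<close> with
  \<open>a \<in> A\<close> and \<open>b \<in> B\<close>, write \<open>b = u + c\<close> with \<open>u \<in> A \<inter> B\<close> and \<open>c \<in> C\<close>; then
  \<open>c = b - u\<close> lies in \<open>B\<close>, and \<open>x = (a + u) + c\<close>.
  Most of the dimension theory rests on this form of the modular law.
\<close>

lemma comaximal_rotate:
  assumes AB: "comaximal A B" and C: "comaximal (A \<inter> B) C"
    and S: "A \<in> S" "B \<in> S" "C \<in> S"
  shows "comaximal A (B \<inter> C)"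
  unfolding comaximal_iff[OF S(1) submodule_Int[OF S(2,3)]]
proof
  fix x assume "x \<in> carrier M"
  then obtain a b where ab: "a \<in> A" "b \<in> B" "x = a \<oplus>\<^bsub>M\<^esub> b"
    using AB comaximal_iff S by blast
  have b: "b \<in> carrier M" using ab S submodule_mem by blast
  obtain u c where uc: "u \<in> A" "u \<in> B" "c \<in> C" "b = u \<oplus>\<^bsub>M\<^esub> c"
    using C comaximal_iff[OF submodule_Int[OF S(1,2)] S(3)] b by (meson IntE)
  have car: "a \<in> carrier M" "u \<in> carrier M" "c \<in> carrier M"
    using ab uc S submodule_mem by blast+
  have "c = \<ominus>\<^bsub>M\<^esub> u \<oplus>\<^bsub>M\<^esub> b" using uc car by (simp add: M.r_neg1)
  then have "c \<in> B" using S uc ab submodule_add submodule_minus by blast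
  moreover have "x = (a \<oplus>\<^bsub>M\<^esub> u) \<oplus>\<^bsub>M\<^esub> c" using ab uc car by (simp add: M.a_assoc)
  moreover have "a \<oplus>\<^bsub>M\<^esub> u \<in> A" using S ab uc submodule_add by blast
  ultimately show "\<exists>a\<in>A. \<exists>b\<in>B \<inter> C. x = a \<oplus>\<^bsub>M\<^esub> b" using uc by blast
qed

definition meet :: "(nat \<Rightarrow> 'm set) \<Rightarrow> nat set \<Rightarrow> 'm set" where
  "meet H I = carrier M \<inter> (\<Inter>i\<in>I. H i)"

lemma meet_empty [simp]: "meet H {} = carrier M"
  by (simp add: meet_def)

lemma meet_insert: "meet H (insert i I) = meet H I \<inter> H i"
  by (auto simp: meet_def)

lemma meet_Suc: "meet H {..<Suc k} = meet H {..<k} \<inter> H k"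
  by (auto simp: meet_def lessThan_Suc)

lemma meet_cong: "(\<And>i. i \<in> I \<Longrightarrow> H i = H' i) \<Longrightarrow> meet H I = meet H' I"
  by (simp add: meet_def)

lemma meet_submodule: "(\<And>i. i \<in> I \<Longrightarrow> H i \<in> S) \<Longrightarrow> meet H I \<in> S"
  by (auto simp: submodule_iff meet_def)

lemma meet_superset: "N \<in> S \<Longrightarrow> (\<And>i. i \<in> I \<Longrightarrow> N \<subseteq> H i) \<Longrightarrow> N \<subseteq> meet H I"
  by (auto simp: meet_def submodule_iff)

section \<open>Hollow dimension of a quotient, expressed in the submodule lattice\<close>

definition hollow_quotient :: "'m set \<Rightarrow> bool" where
  "hollow_quotient H \<longleftrightarrow> H \<in> S \<and> H \<noteq> carrier M \<and>
    (\<forall>A\<in>S. \<forall>B\<in>S. H \<subseteq> A \<longrightarrow> H \<subseteq> B \<longrightarrow> comaximal A B \<longrightarrow> A = carrier M \<or> B = carrier M)"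

text \<open>
  The sequential form of coindependence, comparing each member only with the earlier ones, is
  convenient for induction and for appending families. The order of the members does not matter,
  as iterating \<open>comaximal_rotate\<close> shows.
\<close>

definition coindependent :: "nat \<Rightarrow> (nat \<Rightarrow> 'm set) \<Rightarrow> bool" where
  "coindependent n H \<longleftrightarrow> (\<forall>k<n. H k \<in> S \<and> comaximal (meet H {..<k}) (H k))"

text \<open>For \<open>N \<subseteq> A\<close> this says that \<open>A/N\<close> is small in \<open>M/N\<close>.\<close>

definition small_over :: "'m set \<Rightarrow> 'm set \<Rightarrow> bool" where
  "small_over N A \<longleftrightarrow> (\<forall>X\<in>S. N \<subseteq> X \<longrightarrow> comaximal X A \<longrightarrow> X = carrier M)"

text \<open>
  By the Chinese remainder theorem, a coindependent family \<open>H 0, \<dots>, H (n - 1)\<close> above \<open>N\<close> is the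
  same as an epimorphism from \<open>M/N\<close> onto the direct sum of the modules \<open>M/H i\<close>, whose kernel is
  the quotient by \<open>N\<close> of the intersection.
\<close>

definition hollow_basis :: "'m set \<Rightarrow> nat \<Rightarrow> (nat \<Rightarrow> 'm set) \<Rightarrow> bool" where
  "hollow_basis N n H \<longleftrightarrow> coindependent n H \<and> (\<forall>i<n. hollow_quotient (H i) \<and> N \<subseteq> H i) \<and>
    small_over N (meet H {..<n})"

lemma coindependent_meet: "coindependent n H \<Longrightarrow> I \<subseteq> {..<n} \<Longrightarrow> meet H I \<in> S"
  by (rule meet_submodule) (auto simp: coindependent_def)

lemma hollow_quotientD:
  "hollow_quotient H \<Longrightarrow> comaximal A B \<Longrightarrow> H \<subseteq> A \<Longrightarrow> H \<subseteq> B \<Longrightarrow> A \<in> S \<Longrightarrow> B \<in> S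
    \<Longrightarrow> A \<noteq> carrier M \<Longrightarrow> B = carrier M"
  unfolding hollow_quotient_def by blast

lemma small_overD: "small_over N A \<Longrightarrow> comaximal X A \<Longrightarrow> X \<in> S \<Longrightarrow> N \<subseteq> X \<Longrightarrow> X = carrier M"
  by (simp add: small_over_def)

lemma coindependent_Suc:
  "coindependent (Suc n) H \<longleftrightarrow> coindependent n H \<and> H n \<in> S \<and> comaximal (meet H {..<n}) (H n)"
  by (auto simp: coindependent_def less_Suc_eq)

text \<open>
  The lattice dual of: if \<open>V\<^sub>i\<close> is a nonzero submodule of the uniform module \<open>U\<^sub>i\<close> and the \<open>U\<^sub>i\<close> are
  independent, then the sum of the \<open>V\<^sub>i\<close> is essential in the sum of the \<open>U\<^sub>i\<close>. One summand is
  exchanged at a time. Quantifying over \<open>X\<close> matters, since to exchange the last summand the induction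
  hypothesis is applied to the intersection of \<open>X\<close> with the last \<open>V i\<close>.
\<close>

lemma comaximal_meet_enlarge:
  assumes "coindependent n H" "\<And>i. i < n \<Longrightarrow> hollow_quotient (H i)"
    "\<And>i. i < n \<Longrightarrow> V i \<in> S \<and> H i \<subseteq> V i \<and> V i \<noteq> carrier M"
    "X \<in> S" "comaximal X (meet V {..<n})"
  shows "comaximal X (meet H {..<n})"
  using assms
proof (induction n arbitrary: X)
  case 0
  then show ?case by simp
next
  case (Suc n)
  let ?E = "meet V {..<n}" and ?C = "meet H {..<n}" and ?V = "V n" and ?H = "H n"
  have C: "?C \<in> S" and H: "?H \<in> S" and CH: "comaximal ?C ?H" and co: "coindependent n H"
    using Suc.prems(1) coindependent_meet[of n H] by (auto simp: coindependent_Suc)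
  have E: "?E \<in> S" by (rule meet_submodule) (use Suc.prems(3) in auto)
  have V: "?V \<in> S" "?H \<subseteq> ?V" "?V \<noteq> carrier M" using Suc.prems(3)[of n] by auto
  have X: "X \<in> S" by fact
  have "?C \<subseteq> ?E" unfolding meet_def by (intro Int_mono INT_anti_mono order_refl) (use Suc.prems(3) in auto)
  then have EV: "comaximal ?E ?V" by (intro comaximal_mono[OF CH]) (use V C H E in auto)
  have XEV: "comaximal X (?E \<inter> ?V)" using Suc.prems(5) by (simp add: meet_Suc)
  have "comaximal ?E (?V \<inter> X)"
    by (rule comaximal_rotate[OF EV comaximal_sym[OF XEV]]) (use E V X in auto)
  then have "comaximal (?V \<inter> X) ?E" by (rule comaximal_sym) (use E V X in auto)
  then have VXC: "comaximal (?V \<inter> X) ?C"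
    using Suc.IH[OF co] Suc.prems(2,3) submodule_Int V X by simp
  have VX: "comaximal ?V X"
    by (rule comaximal_sym[OF comaximal_mono[OF XEV]]) (use E V X in auto)
  have "comaximal ?V (X \<inter> ?C)"
    by (rule comaximal_rotate[OF VX VXC]) (use V X C in auto)
  then have "comaximal ?V ((X \<inter> ?C) <+>\<^bsub>M\<^esub> ?H)"
    by (rule comaximal_mono) (use V X C H in \<open>auto intro: subset_sum_left[THEN subsetD]\<close>)
  then have "(X \<inter> ?C) <+>\<^bsub>M\<^esub> ?H = carrier M"
    by (rule hollow_quotientD[rotated])
      (use V X C H Suc.prems(2)[of n] in \<open>auto intro: subset_sum_right[THEN subsetD]\<close>)
  then have XCH: "comaximal (X \<inter> ?C) ?H" by (simp add: comaximal_def)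
  have XC: "comaximal X ?C"
    by (rule comaximal_mono[OF VXC]) (use V X C in auto)
  have "comaximal X (?C \<inter> ?H)"
    by (rule comaximal_rotate[OF XC XCH]) (use X C H in auto)
  then show ?case by (simp add: meet_Suc)
qed

text \<open>
  If \<open>Y\<close> is comaximal to no \<open>H i\<close>, then every \<open>H i\<close> can be enlarged to the proper submodule
  \<open>Y + H i\<close>. The intersection of the enlarged family contains \<open>Y\<close>, and it is as small as the
  intersection of the basis.
\<close>

lemma small_over_if_not_comaximal:
  assumes basis: "hollow_basis N n H" and Y: "Y \<in> S"
    and not: "\<And>i. i < n \<Longrightarrow> \<not> comaximal Y (H i)"
  shows "small_over N Y"
  unfolding small_over_def
proof (intro ballI impI)
  fix X assume X: "X \<in> S" "N \<subseteq> X" and XY: "comaximal X Y"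
  have H: "hollow_quotient (H i)" "H i \<in> S" if "i < n" for i
    using basis that by (auto simp: hollow_basis_def coindependent_def)
  let ?V = "\<lambda>i. Y <+>\<^bsub>M\<^esub> H i"
  have V: "?V i \<in> S \<and> H i \<subseteq> ?V i \<and> ?V i \<noteq> carrier M" "Y \<subseteq> ?V i" if "i < n" for i
    using that not Y H submodule_sum subset_sum_right subset_sum_left
    by (auto simp: comaximal_def)
  have mV: "meet ?V {..<n} \<in> S" by (rule meet_submodule) (use V in auto)
  have "Y \<subseteq> meet ?V {..<n}" by (rule meet_superset) (use V Y in auto)
  then have "comaximal X (meet ?V {..<n})"
    by (intro comaximal_mono[OF XY]) (use X Y mV in auto)
  then have "comaximal X (meet H {..<n})"
    using comaximal_meet_enlarge[of n H ?V X] basis H V X by (simp add: hollow_basis_def)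
  then show "X = carrier M"
    using basis X small_overD unfolding hollow_basis_def by blast
qed

section \<open>Comparing coindependent families with a hollow basis\<close>

text \<open>
  If \<open>H\<close> is a hollow basis over \<open>N\<close> and \<open>N \<subseteq> A\<close>, then this number is \<open>n\<close> minus the hollow dimension
  of \<open>M/A\<close>; dually, it counts the members of a basis that can be chosen independent of a given
  submodule.
\<close>

definition free_rank :: "nat \<Rightarrow> (nat \<Rightarrow> 'm set) \<Rightarrow> 'm set \<Rightarrow> nat" where
  "free_rank n H A = Max (card ` {G. G \<subseteq> {..<n} \<and> comaximal A (meet H G)})"

lemma free_rank_witness:
  assumes "A \<in> S"
  obtains G where "G \<subseteq> {..<n}" "comaximal A (meet H G)" "card G = free_rank n H A"
proof -
  let ?F = "{G. G \<subseteq> {..<n} \<and> comaximal A (meet H G)}"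
  have "finite ?F" by (rule finite_subset[of _ "Pow {..<n}"]) auto
  moreover have "{} \<in> ?F" using assms by (simp add: comaximal_carrier)
  ultimately have "free_rank n H A \<in> card ` ?F"
    unfolding free_rank_def by (intro Max_in) auto
  then show ?thesis using that by auto
qed

lemma free_rank_ge:
  assumes "G \<subseteq> {..<n}" "comaximal A (meet H G)"
  shows "card G \<le> free_rank n H A"
proof -
  have "finite {G. G \<subseteq> {..<n} \<and> comaximal A (meet H G)}"
    by (rule finite_subset[of _ "Pow {..<n}"]) auto
  then show ?thesis unfolding free_rank_def using assms by (intro Max_ge) auto
qed

lemma free_rank_le: "A \<in> S \<Longrightarrow> free_rank n H A \<le> n"
  by (metis free_rank_witness card_lessThan card_mono finite_lessThan)

text \<open>
  If \<open>G\<close> is optimal for \<open>A \<inter> L\<close>, then \<open>A \<inter> meet H G\<close> is comaximal to the proper submodule \<open>L\<close>, so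
  it is not small; hence it is comaximal to some member \<open>H j\<close> of the basis, and \<open>j\<close> can be added
  to \<open>G\<close> when \<open>A \<inter> L\<close> is enlarged to \<open>A\<close>.
\<close>

lemma free_rank_Int_less:
  assumes basis: "hollow_basis N n H" and S: "A \<in> S" "L \<in> S"
    and AL: "comaximal A L" and L: "L \<noteq> carrier M" "N \<subseteq> L"
  shows "free_rank n H (A \<inter> L) < free_rank n H A"
proof -
  obtain G where G: "G \<subseteq> {..<n}" "comaximal (A \<inter> L) (meet H G)"
    and card: "card G = free_rank n H (A \<inter> L)"
    using free_rank_witness[OF submodule_Int[OF S]] .
  have H: "H i \<in> S" "H i \<noteq> carrier M" if "i < n" for i
    using basis that by (auto simp: hollow_basis_def hollow_quotient_def)
  let ?G = "meet H G"
  have mG: "?G \<in> S" by (rule meet_submodule) (use G H in auto)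
  let ?Y = "A \<inter> ?G"
  have Y: "?Y \<in> S" using S mG by simp
  have "comaximal L (A \<inter> ?G)"
    by (rule comaximal_rotate) (use AL G S mG in \<open>auto intro: comaximal_sym simp: Int_commute\<close>)
  then have "\<not> small_over N ?Y" using L S small_overD by blast
  then obtain j where j: "j < n" "comaximal ?Y (H j)"
    using small_over_if_not_comaximal[OF basis Y] by blast
  have "j \<notin> G"
  proof
    assume "j \<in> G"
    then have "?Y \<subseteq> H j" by (auto simp: meet_def)
    then show False using comaximal_subset[OF j(2)] H[OF j(1)] by blast
  qed
  have "comaximal A ?G"
    by (rule comaximal_mono[OF G(2)]) (use S mG in auto)
  then have "comaximal A (?G \<inter> H j)"
    by (rule comaximal_rotate) (use j H S mG in auto)
  then have "card (insert j G) \<le> free_rank n H A"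
    using G j by (intro free_rank_ge) (auto simp: meet_insert)
  moreover have "card (insert j G) = Suc (card G)"
    using \<open>j \<notin> G\<close> G finite_subset by (metis card_insert_disjoint finite_lessThan)
  ultimately show ?thesis using card by simp
qed

text \<open>
  The free rank starts at no more than \<open>n\<close> and drops with every member of \<open>L\<close> that is added to the
  intersection.
\<close>

lemma coindependent_length_le:
  assumes basis: "hollow_basis N n H" and co: "coindependent m L"
    and L: "\<And>i. i < m \<Longrightarrow> L i \<noteq> carrier M \<and> N \<subseteq> L i"
  shows "m \<le> n"
proof -
  have "free_rank n H (meet L {..<k}) + k \<le> n" if "k \<le> m" for k
    using that
  proof (induction k)
    case 0
    then show ?case by (simp add: free_rank_le submodule_carrier)
  next
    case (Suc k)
    have "free_rank n H (meet L {..<k} \<inter> L k) < free_rank n H (meet L {..<k})"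
      using Suc.prems co L
      by (intro free_rank_Int_less[OF basis] coindependent_meet[OF co])
        (auto simp: coindependent_def)
    then show ?case using Suc by (simp add: meet_Suc)
  qed
  from this[of m] show ?thesis by simp
qed

lemma hollow_basis_unique: "hollow_basis N n H \<Longrightarrow> hollow_basis N m L \<Longrightarrow> n = m"
  using coindependent_length_le[of N n H m L] coindependent_length_le[of N m L n H]
  by (auto simp: hollow_basis_def hollow_quotient_def intro: le_antisym)

section \<open>Existence of hollow bases\<close>

text \<open>
  These are the descents that condition (c) asks for. Well-foundedness means that there is no
  infinite coindependent sequence of proper submodules: the intersections of the initial segments
  of such a sequence descend, and the submodules \<open>L\<close> used in an infinite descent are coindependent.
\<close>

definition cosplit :: "'m set rel" where
  "cosplit = {(A \<inter> L, A) | A L. A \<in> S \<and> L \<in> S \<and> comaximal A L \<and> L \<noteq> carrier M}"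

text \<open>
  If \<open>M/A\<close> has no hollow quotient, then pieces can be split off forever: \<open>M/A\<close> itself is not
  hollow, so \<open>A\<close> lies below proper comaximal \<open>B\<close> and \<open>A'\<close>, and \<open>M/A'\<close> again has no hollow quotient.
  In the induction, \<open>C\<close> is the intersection of the submodules \<open>B\<close> obtained so far; it descends along
  the relation and stays comaximal to the current \<open>A\<close>.
\<close>

lemma ex_hollow_quotient_superset:
  assumes wf: "wf cosplit" and "A \<in> S" "A \<noteq> carrier M"
  shows "\<exists>H. hollow_quotient H \<and> A \<subseteq> H"
proof -
  have "\<exists>H. hollow_quotient H \<and> A \<subseteq> H"
    if "C \<in> S" "A \<in> S" "A \<noteq> carrier M" "comaximal C A" for C A
    using wf that
  proof (induction C arbitrary: A rule: wf_induct_rule)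
    case (less C)
    show ?case
    proof (cases "hollow_quotient A")
      case True
      then show ?thesis by blast
    next
      case False
      then obtain B A' where B: "B \<in> S" "A \<subseteq> B" "B \<noteq> carrier M"
        and A': "A' \<in> S" "A \<subseteq> A'" "A' \<noteq> carrier M" and BA': "comaximal A' B"
        using less.prems unfolding hollow_quotient_def by blast
      have "comaximal C B" 
        by (rule comaximal_mono[OF less.prems(4)]) (use less.prems B in auto)
      then have "(C \<inter> B, C) \<in> cosplit" unfolding cosplit_def using less.prems B by blast
      moreover have "comaximal (A' \<inter> B) C"
        by (rule comaximal_mono[OF comaximal_sym[OF less.prems(4)]])
          (use less.prems B A' in auto)
      then have "comaximal A' (B \<inter> C)"
        by (rule comaximal_rotate[OF BA']) (use less.prems B A' in auto)
      then have "comaximal (C \<inter> B) A'"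
        unfolding Int_commute[of C B] by (rule comaximal_sym) (use less.prems B A' in auto)
      ultimately have "\<exists>H. hollow_quotient H \<and> A' \<subseteq> H"
        using A' B less.prems by (intro less.IH[of "C \<inter> B" A']) auto
      then show ?thesis using A' by blast
    qed
  qed
  from this[of "carrier M" A] show ?thesis
    using assms comaximal_sym[OF comaximal_carrier] by simp
qed

text \<open>
  If \<open>X + C = M\<close> for a proper \<open>X\<close> above \<open>N\<close>, where \<open>C\<close> is the intersection of the family found so
  far, then a submodule above \<open>X\<close> with hollow quotient prolongs the family and makes \<open>C\<close> descend.
\<close>

lemma ex_hollow_basis:
  assumes wf: "wf cosplit" and N: "N \<in> S"
  shows "\<exists>n H. hollow_basis N n H"
proof -
  have "\<exists>n H. hollow_basis N n H"
    if "coindependent n H" "\<forall>i<n. hollow_quotient (H i) \<and> N \<subseteq> H i" "C = meet H {..<n}" for C n H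
    using wf that
  proof (induction C arbitrary: n H rule: wf_induct_rule)
    case (less C)
    have C: "C \<in> S" using less.prems coindependent_meet[of n H] by simp
    show ?case
    proof (cases "small_over N C")
      case True
      then show ?thesis using less.prems unfolding hollow_basis_def by blast
    next
      case False
      then obtain X where X: "X \<in> S" "N \<subseteq> X" "comaximal X C" "X \<noteq> carrier M"
        unfolding small_over_def by blast
      obtain K where K: "hollow_quotient K" "X \<subseteq> K"
        using ex_hollow_quotient_superset[OF wf] X by blast
      have KS: "K \<in> S" "K \<noteq> carrier M" using K by (simp_all add: hollow_quotient_def)
      have CK: "comaximal C K"
        by (rule comaximal_mono[OF comaximal_sym[OF X(3)]]) (use X C K KS in auto)
      let ?H = "H(n := K)"
      have meet_eq: "meet ?H {..<k} = meet H {..<k}" if "k \<le> n" for k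
        by (rule meet_cong) (use that in auto)
      have "(C \<inter> K, C) \<in> cosplit" unfolding cosplit_def using C KS CK by blast
      moreover have "coindependent (Suc n) ?H"
        using less.prems CK KS by (auto simp: coindependent_def less_Suc_eq meet_eq)
      moreover have "\<forall>i<Suc n. hollow_quotient (?H i) \<and> N \<subseteq> ?H i"
        using less.prems K X by (auto simp: less_Suc_eq)
      moreover have "C \<inter> K = meet ?H {..<Suc n}"
        using less.prems by (simp add: meet_Suc meet_eq)
      ultimately show ?thesis by (rule less.IH)
    qed
  qed
  from this[of 0] show ?thesis by (simp add: coindependent_def)
qed

lemma wf_cosplit_if_hollow_basis:
  assumes basis: "hollow_basis {\<zero>\<^bsub>M\<^esub>} n H"
  shows "wf cosplit"
proof (rule wf_subset)
  show "wf (measure (free_rank n H))" by simp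
  show "cosplit \<subseteq> measure (free_rank n H)"
    using free_rank_Int_less[OF basis] submodule_zero unfolding cosplit_def by force
qed

section \<open>The hollow dimension of quotients is additive\<close>

text \<open>
  Smallness is compatible with the decomposition of \<open>M/(N \<inter> L)\<close> as the direct sum of \<open>M/N\<close> and
  \<open>M/L\<close>. If \<open>X + (A \<inter> B) = M\<close>, smallness of \<open>A\<close> gives \<open>N + (B \<inter> X) = M\<close>; rotating this, smallness
  of \<open>B\<close> gives \<open>L + (X \<inter> N) = M\<close>. With \<open>N \<inter> L \<subseteq> X\<close> the latter yields \<open>N \<subseteq> X\<close>, and then the former
  yields \<open>X = M\<close>.
\<close>

lemma small_over_Int:
  assumes NL: "comaximal N L" and A: "small_over N A" "N \<subseteq> A" and B: "small_over L B" "L \<subseteq> B"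
    and S: "N \<in> S" "L \<in> S" "A \<in> S" "B \<in> S"
  shows "small_over (N \<inter> L) (A \<inter> B)"
  unfolding small_over_def
proof (intro ballI impI)
  fix X assume X: "X \<in> S" and NLX: "N \<inter> L \<subseteq> X" and XAB: "comaximal X (A \<inter> B)"
  have AB: "comaximal A B" by (rule comaximal_mono[OF NL]) (use A B S in auto)
  have BX: "comaximal B X"
    by (rule comaximal_mono[OF comaximal_sym[OF XAB]]) (use S X in auto)
  have "comaximal A (B \<inter> X)"
    by (rule comaximal_rotate[OF AB comaximal_sym[OF XAB]]) (use S X in auto)
  then have "comaximal (N <+>\<^bsub>M\<^esub> (B \<inter> X)) A"
    by (rule comaximal_mono[of A "B \<inter> X" A "N <+>\<^bsub>M\<^esub> (B \<inter> X)", THEN comaximal_sym])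
      (use S X subset_sum_right in auto)
  then have "N <+>\<^bsub>M\<^esub> (B \<inter> X) = carrier M"
    by (rule small_overD[OF A(1)]) (use S X subset_sum_left in auto)
  then have NBX: "comaximal N (B \<inter> X)" by (simp add: comaximal_def)
  then have "comaximal (B \<inter> X) N" by (rule comaximal_sym) (use S X in auto)
  then have "comaximal B (X \<inter> N)"
    by (rule comaximal_rotate[OF BX]) (use S X in auto)
  then have "comaximal (L <+>\<^bsub>M\<^esub> (X \<inter> N)) B"
    by (rule comaximal_mono[of B "X \<inter> N" B "L <+>\<^bsub>M\<^esub> (X \<inter> N)", THEN comaximal_sym])
      (use S X subset_sum_right in auto)
  then have L: "L <+>\<^bsub>M\<^esub> (X \<inter> N) = carrier M"
    by (rule small_overD[OF B(1)]) (use S X subset_sum_left in auto)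
  have "N \<subseteq> X"
  proof
    fix x assume x: "x \<in> N"
    then obtain l y where ly: "l \<in> L" "y \<in> X" "y \<in> N" "x = l \<oplus>\<^bsub>M\<^esub> y"
      using L submodule_mem S by (metis IntE set_add_iff)
    have car: "l \<in> carrier M" "y \<in> carrier M" using ly S submodule_mem by blast+
    have "l = x \<ominus>\<^bsub>M\<^esub> y" using ly car by (simp add: M.minus_eq M.a_assoc M.r_neg)
    then have "l \<in> N" using submodule_diff S x ly by blast
    then show "x \<in> X" using ly NLX submodule_add X by blast
  qed
  then show "X = carrier M" using comaximal_subset[OF NBX] X by blast
qed

lemma hollow_basis_append:
  assumes NL: "comaximal N L" and S: "N \<in> S" "L \<in> S"
    and G: "hollow_basis N n G" and H: "hollow_basis L m H"
  shows "hollow_basis (N \<inter> L) (n + m) (\<lambda>i. if i < n then G i else H (i - n))"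
    (is "hollow_basis _ _ ?F")
proof -
  have coG: "coindependent n G" and coH: "coindependent m H"
    and hG: "\<And>i. i < n \<Longrightarrow> hollow_quotient (G i) \<and> N \<subseteq> G i"
    and hH: "\<And>i. i < m \<Longrightarrow> hollow_quotient (H i) \<and> L \<subseteq> H i"
    using G H by (auto simp: hollow_basis_def)
  let ?A = "meet G {..<n}"
  have A: "?A \<in> S" by (rule coindependent_meet[OF coG]) simp
  have NA: "N \<subseteq> ?A" by (rule meet_superset) (use hG S in auto)
  have mH: "meet H {..<k} \<in> S" "L \<subseteq> meet H {..<k}" if "k \<le> m" for k
    using that coindependent_meet[OF coH] hH S meet_superset[of L "{..<k}" H] by auto
  have F1: "meet ?F {..<k} = meet G {..<k}" if "k \<le> n" for k
    by (rule meet_cong) (use that in auto)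
  have F2: "meet ?F {..<n + k} = ?A \<inter> meet H {..<k}" for k
  proof (induction k)
    case 0
    then show ?case using F1[of n] submodule_subset[OF A] by auto
  qed (simp add: meet_Suc Int_assoc)
  have "comaximal (meet ?F {..<k}) (?F k)" if k: "k < n + m" for k
  proof (cases "k < n")
    case True
    then show ?thesis using coG F1[of k] by (simp add: coindependent_def)
  next
    case False
    define j where "j = k - n"
    have j: "k = n + j" "j < m" using False k by (auto simp: j_def)
    have Hj: "H j \<in> S" "comaximal (meet H {..<j}) (H j)" using coH j by (auto simp: coindependent_def)
    have S': "meet H {..<j} \<in> S" using mH[of j] j by simp
    have LS: "L \<subseteq> H j \<inter> meet H {..<j}" using mH[of "Suc j"] j by (auto simp: meet_Suc)
    have "comaximal (H j \<inter> meet H {..<j}) ?A"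
      by (rule comaximal_mono[OF comaximal_sym[OF NL]]) (use LS NA A S S' Hj in auto)
    then have "comaximal (H j) (meet H {..<j} \<inter> ?A)"
      by (rule comaximal_rotate[rotated]) (use Hj S' A comaximal_sym in auto)
    then have "comaximal (?A \<inter> meet H {..<j}) (H j)"
      unfolding Int_commute[of ?A] by (rule comaximal_sym) (use Hj S' A in auto)
    then show ?thesis using j F2[of j] by simp
  qed
  moreover have hF: "hollow_quotient (?F i) \<and> N \<inter> L \<subseteq> ?F i" if "i < n + m" for i
  proof (cases "i < n")
    case False
    then have "i - n < m" using that by simp
    then show ?thesis using hH False by auto
  qed (use hG in auto)
  moreover have "?F i \<in> S" if "i < n + m" for i
    using hF[OF that] unfolding hollow_quotient_def by blast
  ultimately have "coindependent (n + m) ?F" unfolding coindependent_def by blast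
  moreover have "small_over (N \<inter> L) (meet ?F {..<n + m})"
    unfolding F2 using G H mH[of m] NA A S
    by (intro small_over_Int[OF NL]) (auto simp: hollow_basis_def)
  ultimately show ?thesis unfolding hollow_basis_def using hF by blast
qed

lemma hollow_basis_0: "hollow_basis N 0 H \<Longrightarrow> N \<in> S \<Longrightarrow> N = carrier M"
  using small_overD[of N "carrier M" N] comaximal_carrier by (simp add: hollow_basis_def)

theorem ex_additive_rank:
  assumes basis: "hollow_basis {\<zero>\<^bsub>M\<^esub>} n B"
  obtains d :: "'m set \<Rightarrow> nat" where "d \<in> S \<rightarrow> {0..n}"
    "\<And>N. N \<in> S \<Longrightarrow> d N = 0 \<Longrightarrow> N = carrier M"
    "\<And>N L. N \<in> S \<Longrightarrow> L \<in> S \<Longrightarrow> comaximal N L \<Longrightarrow> d (N \<inter> L) = d N + d L"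
proof -
  define d where "d N = (THE k. \<exists>H. hollow_basis N k H)" for N
  have ex: "\<exists>k H. hollow_basis N k H" if "N \<in> S" for N
    using ex_hollow_basis[OF wf_cosplit_if_hollow_basis[OF basis] that] .
  have d_eq: "d N = k" if "hollow_basis N k H" for N k H
    unfolding d_def using that hollow_basis_unique by blast
  show thesis
  proof
    show "d \<in> S \<rightarrow> {0..n}"
    proof
      fix N assume N: "N \<in> S"
      then obtain k H where H: "hollow_basis N k H" using ex by blast
      then have "k \<le> n"
        by (intro coindependent_length_le[OF basis, of k H])
          (auto simp: hollow_basis_def hollow_quotient_def submodule_zero)
      then show "d N \<in> {0..n}" using d_eq[OF H] by simp
    qed
  next
    fix N assume N: "N \<in> S" "d N = 0"
    then obtain k H where H: "hollow_basis N k H" using ex by blast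
    then show "N = carrier M" using d_eq[OF H] N hollow_basis_0 by simp
  next
    fix N L assume NL: "N \<in> S" "L \<in> S" "comaximal N L"
    obtain k G m H where G: "hollow_basis N k G" and H: "hollow_basis L m H" using ex NL by meson
    show "d (N \<inter> L) = d N + d L"
      using d_eq[OF hollow_basis_append[OF NL(3,1,2) G H]] d_eq[OF G] d_eq[OF H] by simp
  qed
qed

section \<open>Hollow covers and hollow bases of the zero submodule\<close>

text \<open>
  The basis consists of the kernels \<open>K i\<close> of the components of the cover \<open>g\<close>. Their intersection is
  the kernel of \<open>g\<close>, and \<open>M/(K i)\<close> is isomorphic to \<open>H i\<close>.
\<close>

lemma hollow_basis_if_hollow_cover:
  fixes H :: "nat \<Rightarrow> ('r, 'h, 'u) module_scheme"
  assumes cover: "hollow_cover R M n H g"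
  shows "\<exists>K. hollow_basis {\<zero>\<^bsub>M\<^esub>} n K"
proof -
  let ?D = "direct_sum {..<n} H"
  have hol: "\<And>i. i < n \<Longrightarrow> hollow_module R (H i)"
    and hom: "g \<in> left_module_hom R M ?D"
    and surj: "g ` carrier M = (\<Pi>\<^sub>E i\<in>{..<n}. carrier (H i))"
    and ker: "small_submodule R M (a_kernel M ?D g)"
    using cover by (auto simp: hollow_cover_def direct_sum_simps)
  have md: "left_module R (H i)" if "i < n" for i
    using hol[OF that] by (simp add: hollow_module_def)
  have gi: "g x i \<in> carrier (H i)" if "x \<in> carrier M" "i < n" for x i
    using surj that by auto
  have g_add: "g (x \<oplus>\<^bsub>M\<^esub> y) i = g x i \<oplus>\<^bsub>H i\<^esub> g y i"
    if "x \<in> carrier M" "y \<in> carrier M" "i < n" for x y i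
    using hom that by (simp add: left_module_hom_def hom_def direct_sum_simps)
  have g_smult: "g (a \<odot>\<^bsub>M\<^esub> x) i = a \<odot>\<^bsub>H i\<^esub> g x i"
    if "a \<in> carrier R" "x \<in> carrier M" "i < n" for a x i
    using hom that by (simp add: left_module_hom_def direct_sum_simps)
  have g_zero: "g \<zero>\<^bsub>M\<^esub> i = \<zero>\<^bsub>H i\<^esub>" if i: "i < n" for i
  proof -
    interpret H: left_module R "H i" by (rule md[OF i])
    show ?thesis using g_add[of "\<zero>\<^bsub>M\<^esub>" "\<zero>\<^bsub>M\<^esub>" i] gi[of "\<zero>\<^bsub>M\<^esub>" i] i
      by (simp add: H.add.r_cancel_one')
  qed
  have g_minus: "g (x \<ominus>\<^bsub>M\<^esub> y) i = g x i \<ominus>\<^bsub>H i\<^esub> g y i"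
    if x: "x \<in> carrier M" "y \<in> carrier M" and i: "i < n" for x y i
  proof -
    interpret H: left_module R "H i" by (rule md[OF i])
    have "g (\<ominus>\<^bsub>M\<^esub> y) i \<oplus>\<^bsub>H i\<^esub> g y i = \<zero>\<^bsub>H i\<^esub>"
      using g_add[of "\<ominus>\<^bsub>M\<^esub> y" y i] x i g_zero by (simp add: M.l_neg)
    then have "g (\<ominus>\<^bsub>M\<^esub> y) i = \<ominus>\<^bsub>H i\<^esub> g y i"
      using gi x i by (simp add: H.minus_equality)
    then show ?thesis using g_add[of x "\<ominus>\<^bsub>M\<^esub> y" i] x i by (simp add: M.minus_eq H.minus_eq)
  qed
  define K where "K i = {x \<in> carrier M. g x i = \<zero>\<^bsub>H i\<^esub>}" for i
  have K: "K i \<in> S" if i: "i < n" for i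
  proof -
    interpret H: left_module R "H i" by (rule md[OF i])
    have z: "a \<odot>\<^bsub>H i\<^esub> \<zero>\<^bsub>H i\<^esub> = \<zero>\<^bsub>H i\<^esub>" if "a \<in> carrier R" for a
      using H.smult_r_distr[of a "\<zero>\<^bsub>H i\<^esub>" "\<zero>\<^bsub>H i\<^esub>"] that by (simp add: H.add.r_cancel_one')
    show ?thesis unfolding submodule_iff K_def using i by (auto simp: g_add g_smult g_zero z)
  qed
  \<comment> \<open>Preimages of tuples with one free entry split \<open>M\<close> along \<open>K k\<close> and the other kernels.\<close>
  have single: "\<exists>x\<in>carrier M. g x k = h \<and> (\<forall>i<n. i \<noteq> k \<longrightarrow> g x i = \<zero>\<^bsub>H i\<^esub>)"
    if k: "k < n" and h: "h \<in> carrier (H k)" for k h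
  proof -
    have z: "\<zero>\<^bsub>H i\<^esub> \<in> carrier (H i)" if "i < n" for i
      using gi[of "\<zero>\<^bsub>M\<^esub>" i] g_zero[of i] that by simp
    let ?f = "\<lambda>j\<in>{..<n}. if j = k then h else \<zero>\<^bsub>H j\<^esub>"
    have "?f \<in> g ` carrier M" unfolding surj using h z by auto
    then obtain x where "x \<in> carrier M" "g x = ?f" by (elim imageE) simp
    then show ?thesis using k by (intro bexI[of _ x]) auto
  qed
  have hq: "hollow_quotient (K i)" if i: "i < n" for i
    unfolding hollow_quotient_def
  proof (intro conjI ballI impI)
    interpret H: left_module R "H i" by (rule md[OF i])
    obtain h where h: "h \<in> carrier (H i)" "h \<noteq> \<zero>\<^bsub>H i\<^esub>"
      using hol[OF i] H.zero_closed unfolding hollow_module_def by blast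
    show "K i \<noteq> carrier M" using single[OF i h(1)] h(2) by (auto simp: K_def)
    show "K i \<in> S" using K i .
    fix A B assume AB: "A \<in> S" "B \<in> S" "K i \<subseteq> A" "K i \<subseteq> B" "comaximal A B"
    let ?im = "\<lambda>A. (\<lambda>x. g x i) ` A"
    have im: "?im A \<in> submodules R (H i)" if A: "A \<in> S" for A
      unfolding H.submodule_iff
    proof (intro conjI ballI)
      show "?im A \<subseteq> carrier (H i)" using submodule_mem[OF A] gi i by auto
      show "\<zero>\<^bsub>H i\<^esub> \<in> ?im A" using submodule_zero[OF A] g_zero[OF i] by (metis imageI)
    next
      fix x y assume "x \<in> ?im A" "y \<in> ?im A"
      then show "x \<oplus>\<^bsub>H i\<^esub> y \<in> ?im A"
        using submodule_mem[OF A] submodule_add[OF A] g_add i by (auto simp: image_iff) metis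
    next
      fix a x assume "a \<in> carrier R" "x \<in> ?im A"
      then show "a \<odot>\<^bsub>H i\<^esub> x \<in> ?im A"
        using submodule_mem[OF A] submodule_smult[OF A] g_smult i by (auto simp: image_iff) metis
    qed
    have full: "A = carrier M" if A: "A \<in> S" "K i \<subseteq> A" and e: "?im A = carrier (H i)" for A
    proof
      show "A \<subseteq> carrier M" using A submodule_subset by blast
      show "carrier M \<subseteq> A"
      proof
        fix x assume x: "x \<in> carrier M"
        then have "g x i \<in> ?im A" using gi i e by blast
        then obtain a where a: "a \<in> A" "g x i = g a i" by blast
        have ac: "a \<in> carrier M" using a A submodule_mem by blast
        have "x \<ominus>\<^bsub>M\<^esub> a \<in> K i"
          using a ac x i gi[OF ac i] by (simp add: K_def g_minus H.minus_eq H.r_neg)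
        then have "x \<ominus>\<^bsub>M\<^esub> a \<oplus>\<^bsub>M\<^esub> a \<in> A" using a A submodule_add by blast
        then show "x \<in> A" using x ac by (simp add: M.minus_eq M.a_assoc M.l_neg)
      qed
    qed
    have "?im A <+>\<^bsub>H i\<^esub> ?im B = carrier (H i)"
    proof
      show "?im A <+>\<^bsub>H i\<^esub> ?im B \<subseteq> carrier (H i)"
        using H.submodule_subset[OF H.submodule_sum] im AB by blast
      show "carrier (H i) \<subseteq> ?im A <+>\<^bsub>H i\<^esub> ?im B"
      proof
        fix h assume "h \<in> carrier (H i)"
        then obtain x where x: "x \<in> carrier M" "g x i = h" using single i by blast
        then obtain a b where ab: "a \<in> A" "b \<in> B" "x = a \<oplus>\<^bsub>M\<^esub> b"
          using AB comaximal_iff by meson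
        then have "h = g a i \<oplus>\<^bsub>H i\<^esub> g b i" using x g_add i AB submodule_mem by blast
        then show "h \<in> ?im A <+>\<^bsub>H i\<^esub> ?im B" unfolding H.set_add_iff using ab by blast
      qed
    qed
    then have "?im A = carrier (H i) \<or> ?im B = carrier (H i)"
      using hol[OF i] im[OF AB(1)] im[OF AB(2)]
      unfolding hollow_module_def small_submodule_def by metis
    then show "A = carrier M \<or> B = carrier M" using full AB by blast
  qed
  have mK: "meet K {..<k} \<in> S" if "k \<le> n" for k
    by (rule meet_submodule) (use K that in auto)
  have "comaximal (meet K {..<k}) (K k)" if k: "k < n" for k
  proof (subst comaximal_iff)
    show "meet K {..<k} \<in> S" "K k \<in> S" using mK K k by auto
    show "\<forall>x\<in>carrier M. \<exists>a\<in>meet K {..<k}. \<exists>b\<in>K k. x = a \<oplus>\<^bsub>M\<^esub> b"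
    proof
      interpret H: left_module R "H k" by (rule md[OF k])
      fix x assume x: "x \<in> carrier M"
      obtain y where y: "y \<in> carrier M" "g y k = g x k" "\<forall>i<n. i \<noteq> k \<longrightarrow> g y i = \<zero>\<^bsub>H i\<^esub>"
        using single[OF k gi[OF x k]] by blast
      have "y \<in> meet K {..<k}" using y k by (auto simp: meet_def K_def)
      moreover have "x \<ominus>\<^bsub>M\<^esub> y \<in> K k"
        using x y k gi[OF x k] by (simp add: K_def g_minus H.minus_eq H.r_neg)
      moreover have "x = y \<oplus>\<^bsub>M\<^esub> (x \<ominus>\<^bsub>M\<^esub> y)"
        using x y by (simp add: M.minus_eq M.a_lcomm M.r_neg)
      ultimately show "\<exists>a\<in>meet K {..<k}. \<exists>b\<in>K k. x = a \<oplus>\<^bsub>M\<^esub> b" by blast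
    qed
  qed
  then have co: "coindependent n K" using K by (simp add: coindependent_def)
  have "a_kernel M ?D g = meet K {..<n}"
  proof -
    have "g x = (\<lambda>i\<in>{..<n}. \<zero>\<^bsub>H i\<^esub>) \<longleftrightarrow> (\<forall>i<n. g x i = \<zero>\<^bsub>H i\<^esub>)" if "x \<in> carrier M" for x
    proof -
      have "g x \<in> extensional {..<n}" using surj that by (auto simp: PiE_def)
      then show ?thesis by (auto simp: extensional_def fun_eq_iff)
    qed
    then show ?thesis
      by (auto simp: a_kernel_def kernel_def direct_sum_simps meet_def K_def)
  qed
  then have "small_over {\<zero>\<^bsub>M\<^esub>} (meet K {..<n})"
    using ker comaximal_sym mK[of n] unfolding small_over_def small_submodule_def comaximal_def
    by (metis order_refl)
  then show ?thesis using co hq K submodule_zero unfolding hollow_basis_def by blast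
qed

text \<open>
  Transporting the structure of \<open>M\<close> along a map that identifies exactly the elements congruent
  modulo \<open>K\<close> gives the quotient module \<open>M/K\<close>, computed on representatives.
\<close>

definition coset_of :: "'m set \<Rightarrow> 'm \<Rightarrow> 'm set" where
  "coset_of K x = {y \<in> carrier M. y \<ominus>\<^bsub>M\<^esub> x \<in> K}"

abbreviation quotient :: "'m set \<Rightarrow> ('r, 'm set) module" where
  "quotient K \<equiv> transport (coset_of K) M"

lemma coset_of_eq_iff:
  assumes K: "K \<in> S" and x: "x \<in> carrier M" and y: "y \<in> carrier M"
  shows "coset_of K x = coset_of K y \<longleftrightarrow> x \<ominus>\<^bsub>M\<^esub> y \<in> K"
proof
  assume "coset_of K x = coset_of K y"
  moreover have "x \<in> coset_of K x"
    using submodule_zero[OF K] x by (simp add: coset_of_def M.minus_eq M.r_neg)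
  ultimately show "x \<ominus>\<^bsub>M\<^esub> y \<in> K" by (simp add: coset_of_def)
next
  assume xy: "x \<ominus>\<^bsub>M\<^esub> y \<in> K"
  then have yx: "y \<ominus>\<^bsub>M\<^esub> x \<in> K"
    using submodule_minus[OF K xy] x y by (simp add: minus_diff)
  have "z \<ominus>\<^bsub>M\<^esub> x \<in> K \<longleftrightarrow> z \<ominus>\<^bsub>M\<^esub> y \<in> K" if z: "z \<in> carrier M" for z
    using submodule_add[OF K _ xy, of "z \<ominus>\<^bsub>M\<^esub> x"] submodule_add[OF K _ yx, of "z \<ominus>\<^bsub>M\<^esub> y"]
    by (auto simp: diff_add_diff x y z)
  then show "coset_of K x = coset_of K y" by (auto simp: coset_of_def)
qed

lemma quotient_simps:
  assumes K: "K \<in> S"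
  shows "carrier (quotient K) = coset_of K ` carrier M"
    and "\<zero>\<^bsub>quotient K\<^esub> = coset_of K \<zero>\<^bsub>M\<^esub>"
    and "\<lbrakk>x \<in> carrier M; y \<in> carrier M\<rbrakk>
      \<Longrightarrow> coset_of K x \<oplus>\<^bsub>quotient K\<^esub> coset_of K y = coset_of K (x \<oplus>\<^bsub>M\<^esub> y)"
    and "\<lbrakk>a \<in> carrier R; x \<in> carrier M\<rbrakk>
      \<Longrightarrow> a \<odot>\<^bsub>quotient K\<^esub> coset_of K x = coset_of K (a \<odot>\<^bsub>M\<^esub> x)"
proof -
  let ?\<psi> = "inv_into (carrier M) (coset_of K)"
  have car: "?\<psi> (coset_of K x) \<in> carrier M" if "x \<in> carrier M" for x
    using that by (intro inv_into_into) simp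
  have cls: "?\<psi> (coset_of K x) \<ominus>\<^bsub>M\<^esub> x \<in> K" if "x \<in> carrier M" for x
    using that f_inv_into_f[of "coset_of K x" "coset_of K" "carrier M"]
      coset_of_eq_iff[OF K car[OF that] that] by simp
  show "coset_of K x \<oplus>\<^bsub>quotient K\<^esub> coset_of K y = coset_of K (x \<oplus>\<^bsub>M\<^esub> y)"
    if x: "x \<in> carrier M" and y: "y \<in> carrier M"
  proof -
    let ?u = "?\<psi> (coset_of K x)" and ?v = "?\<psi> (coset_of K y)"
    have "(?u \<oplus>\<^bsub>M\<^esub> ?v) \<ominus>\<^bsub>M\<^esub> (x \<oplus>\<^bsub>M\<^esub> y) = (?u \<ominus>\<^bsub>M\<^esub> x) \<oplus>\<^bsub>M\<^esub> (?v \<ominus>\<^bsub>M\<^esub> y)"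
      using x y car[OF x] car[OF y] by (simp add: M.minus_eq M.minus_add M.a_ac)
    also have "\<dots> \<in> K" using submodule_add[OF K cls cls] x y .
    finally show ?thesis
      using x y car[OF x] car[OF y] by (simp add: transport_def Let_def coset_of_eq_iff[OF K])
  qed
  show "a \<odot>\<^bsub>quotient K\<^esub> coset_of K x = coset_of K (a \<odot>\<^bsub>M\<^esub> x)"
    if a: "a \<in> carrier R" and x: "x \<in> carrier M"
  proof -
    let ?u = "?\<psi> (coset_of K x)"
    have "a \<odot>\<^bsub>M\<^esub> ?u \<ominus>\<^bsub>M\<^esub> a \<odot>\<^bsub>M\<^esub> x = a \<odot>\<^bsub>M\<^esub> (?u \<ominus>\<^bsub>M\<^esub> x)"
      using a x car[OF x] by (simp add: M.minus_eq smult_r_distr smult_minus)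
    also have "\<dots> \<in> K" using submodule_smult[OF K a cls[OF x]] .
    finally show ?thesis
      using a x car[OF x] by (simp add: transport_def Let_def coset_of_eq_iff[OF K])
  qed
qed (simp_all add: transport_def Let_def)

lemma left_module_quotient:
  assumes K: "K \<in> S"
  shows "left_module R (quotient K)"
proof -
  note [simp] = quotient_simps[OF K]
  have "abelian_group (quotient K)"
  proof (rule abelian_groupI)
    fix X assume "X \<in> carrier (quotient K)"
    then obtain x where "x \<in> carrier M" "X = coset_of K x" by auto
    then show "\<exists>Y\<in>carrier (quotient K). Y \<oplus>\<^bsub>quotient K\<^esub> X = \<zero>\<^bsub>quotient K\<^esub>"
      by (intro bexI[of _ "coset_of K (\<ominus>\<^bsub>M\<^esub> x)"]) (auto simp: M.l_neg)
  qed (auto simp: M.a_assoc M.a_comm M.a_lcomm)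
  then show ?thesis
    by (intro left_module.intro left_module_axioms.intro R.ring_axioms)
      (auto simp: smult_l_distr smult_r_distr smult_assoc1)
qed

lemma hollow_module_quotient:
  assumes hq: "hollow_quotient K"
  shows "hollow_module R (quotient K)"
proof -
  have K: "K \<in> S" "K \<noteq> carrier M" using hq by (auto simp: hollow_quotient_def)
  note [simp] = quotient_simps[OF K(1)]
  let ?Q = "quotient K"
  interpret Q: left_module R ?Q by (rule left_module_quotient[OF K(1)])
  have in_K: "coset_of K x = coset_of K \<zero>\<^bsub>M\<^esub> \<longleftrightarrow> x \<in> K" if "x \<in> carrier M" for x
    using coset_of_eq_iff[OF K(1) that M.zero_closed] that by (simp add: diff_zero)
  let ?pre = "\<lambda>A. {x \<in> carrier M. coset_of K x \<in> A}"
  have pre: "?pre A \<in> S" "K \<subseteq> ?pre A" if "A \<in> submodules R ?Q" for A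
  proof -
    have A: "coset_of K \<zero>\<^bsub>M\<^esub> \<in> A" "\<And>x y. x \<in> A \<Longrightarrow> y \<in> A \<Longrightarrow> x \<oplus>\<^bsub>?Q\<^esub> y \<in> A"
      "\<And>a x. a \<in> carrier R \<Longrightarrow> x \<in> A \<Longrightarrow> a \<odot>\<^bsub>?Q\<^esub> x \<in> A"
      using that by (auto simp: Q.submodule_iff)
    have "coset_of K (x \<oplus>\<^bsub>M\<^esub> y) \<in> A" if "x \<in> ?pre A" "y \<in> ?pre A" for x y
      using that A(2)[of "coset_of K x" "coset_of K y"] by simp
    moreover have "coset_of K (a \<odot>\<^bsub>M\<^esub> x) \<in> A" if "a \<in> carrier R" "x \<in> ?pre A" for a x
      using that A(3)[of a "coset_of K x"] by simp
    ultimately show "?pre A \<in> S" unfolding submodule_iff using A(1) by auto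
    show "K \<subseteq> ?pre A"
    proof
      fix x assume x: "x \<in> K"
      then have "x \<in> carrier M" using K submodule_mem by blast
      then show "x \<in> ?pre A" using x in_K[of x] A(1) by simp
    qed
  qed
  have full: "A = carrier ?Q" if "A \<in> submodules R ?Q" "?pre A = carrier M" for A
    using that Q.submodule_subset[OF that(1)] by auto
  have "small_submodule R ?Q A" if A: "A \<in> submodules R ?Q" "A \<noteq> carrier ?Q" for A
    unfolding small_submodule_def
  proof (intro conjI ballI impI notI)
    fix B assume B: "B \<in> submodules R ?Q" "B \<noteq> carrier ?Q" and AB: "A <+>\<^bsub>?Q\<^esub> B = carrier ?Q"
    have "comaximal (?pre A) (?pre B)"
      unfolding comaximal_iff[OF pre(1)[OF A(1)] pre(1)[OF B(1)]]
    proof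
      fix x assume x: "x \<in> carrier M"
      then have "coset_of K x \<in> A <+>\<^bsub>?Q\<^esub> B" using AB by simp
      then obtain X Y where XY: "X \<in> A" "Y \<in> B" "coset_of K x = X \<oplus>\<^bsub>?Q\<^esub> Y"
        unfolding Q.set_add_iff by blast
      obtain a where a: "a \<in> carrier M" "X = coset_of K a"
        using Q.submodule_mem[OF A(1) XY(1)] by auto
      obtain b where b: "b \<in> carrier M" "Y = coset_of K b"
        using Q.submodule_mem[OF B(1) XY(2)] by auto
      \<comment> \<open>Only \<open>x \<equiv> a + b\<close> modulo \<open>K\<close> is known, so \<open>b\<close> is corrected to \<open>x - a\<close>.\<close>
      let ?b = "x \<ominus>\<^bsub>M\<^esub> a"
      have "coset_of K x = coset_of K (a \<oplus>\<^bsub>M\<^esub> b)" using XY a b by simp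
      then have "x \<ominus>\<^bsub>M\<^esub> (a \<oplus>\<^bsub>M\<^esub> b) \<in> K" using coset_of_eq_iff[OF K(1)] x a b by simp
      moreover have "x \<ominus>\<^bsub>M\<^esub> (a \<oplus>\<^bsub>M\<^esub> b) = ?b \<ominus>\<^bsub>M\<^esub> b"
        using x a b by (simp add: M.minus_eq M.minus_add M.a_assoc)
      ultimately have "coset_of K ?b = coset_of K b"
        using coset_of_eq_iff[OF K(1)] x a b by simp
      then have "?b \<in> ?pre B" using x a b XY by simp
      moreover have "x = a \<oplus>\<^bsub>M\<^esub> ?b"
        using x a by (simp add: M.minus_eq M.a_lcomm[of a x] M.r_neg)
      moreover have "a \<in> ?pre A" using a XY by simp
      ultimately show "\<exists>a\<in>?pre A. \<exists>b\<in>?pre B. x = a \<oplus>\<^bsub>M\<^esub> b" by blast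
    qed
    then have "?pre B = carrier M"
      by (rule hollow_quotientD[OF hq]) (use pre A B full in blast)+
    then show False using full B by blast
  qed (use A in simp)
  moreover have "carrier ?Q \<noteq> {\<zero>\<^bsub>?Q\<^esub>}"
  proof -
    obtain x where x: "x \<in> carrier M" "x \<notin> K" using K submodule_subset by blast
    then have "coset_of K x \<noteq> coset_of K \<zero>\<^bsub>M\<^esub>" using in_K by blast
    then show ?thesis using x by auto
  qed
  ultimately show ?thesis
    using Q.left_module_axioms unfolding hollow_module_def by blast
qed

text \<open>
  The surjectivity half of the Chinese remainder theorem. To correct a solution \<open>x\<close> of the first
  \<open>k\<close> congruences, split \<open>y k - x\<close> along the intersection of the first \<open>k\<close> submodules and the next.
\<close>

lemma coindependent_chinese_remainder:
  assumes co: "coindependent n K" and y: "\<And>i. i < n \<Longrightarrow> y i \<in> carrier M"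
  shows "\<exists>x\<in>carrier M. \<forall>i<n. coset_of (K i) x = coset_of (K i) (y i)"
  using assms
proof (induction n)
  case 0
  then show ?case using M.zero_closed by blast
next
  case (Suc n)
  then obtain x where x: "x \<in> carrier M" "\<forall>i<n. coset_of (K i) x = coset_of (K i) (y i)"
    by (auto simp: coindependent_Suc)
  have yn: "y n \<in> carrier M" using Suc.prems by simp
  have K: "K i \<in> S" if "i < Suc n" for i using Suc.prems(1) that by (simp add: coindependent_def)
  have mK: "meet K {..<n} \<in> S" by (rule meet_submodule) (use K in auto)
  obtain m h where mh: "m \<in> meet K {..<n}" "h \<in> K n" "y n \<ominus>\<^bsub>M\<^esub> x = m \<oplus>\<^bsub>M\<^esub> h"
    using Suc.prems(1) comaximal_iff[OF mK K[of n]] x yn by (auto simp: coindependent_Suc) blast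
  have car: "m \<in> carrier M" "h \<in> carrier M" using mh mK K submodule_mem by blast+
  have "coset_of (K i) (x \<oplus>\<^bsub>M\<^esub> m) = coset_of (K i) (y i)" if i: "i < Suc n" for i
  proof (cases "i = n")
    case True
    have "y n = (y n \<ominus>\<^bsub>M\<^esub> x) \<oplus>\<^bsub>M\<^esub> x"
      using x yn by (simp add: M.minus_eq M.a_assoc M.l_neg)
    also have "\<dots> = (x \<oplus>\<^bsub>M\<^esub> m) \<oplus>\<^bsub>M\<^esub> h" using mh x car by (simp add: M.a_ac)
    finally have "y n \<ominus>\<^bsub>M\<^esub> (x \<oplus>\<^bsub>M\<^esub> m) = h"
      using x car by (simp add: M.minus_eq M.minus_add M.a_ac M.r_neg M.r_neg1 M.r_neg2)
    then have "coset_of (K n) (y n) = coset_of (K n) (x \<oplus>\<^bsub>M\<^esub> m)"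
      using coset_of_eq_iff[OF K, of n] mh x car yn by simp
    then show ?thesis using True by simp
  next
    case False
    have "m \<in> K i" using mh False i by (auto simp: meet_def)
    moreover have "x \<oplus>\<^bsub>M\<^esub> m \<ominus>\<^bsub>M\<^esub> x = m"
      using x car by (simp add: M.minus_eq M.a_ac M.r_neg M.r_neg1 M.r_neg2)
    ultimately have "coset_of (K i) (x \<oplus>\<^bsub>M\<^esub> m) = coset_of (K i) x"
      using coset_of_eq_iff[OF K[OF i]] x car by simp
    then show ?thesis using x False i by simp
  qed
  then show ?case using x car by blast
qed

lemma has_finite_hollow_dimension_if_hollow_basis:
  assumes basis: "hollow_basis {\<zero>\<^bsub>M\<^esub>} n K"
  shows "has_finite_hollow_dimension R M"
proof -
  let ?Q = "\<lambda>i. quotient (K i)"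
  let ?D = "direct_sum {..<n} ?Q"
  define g where "g x = (\<lambda>i\<in>{..<n}. coset_of (K i) x)" for x
  have co: "coindependent n K" and hq: "\<And>i. i < n \<Longrightarrow> hollow_quotient (K i)"
    and small: "small_over {\<zero>\<^bsub>M\<^esub>} (meet K {..<n})"
    using basis by (auto simp: hollow_basis_def)
  have K: "K i \<in> S" if "i < n" for i using co that by (simp add: coindependent_def)
  have hom: "g \<in> left_module_hom R M ?D"
    unfolding left_module_hom_def hom_def
    by (auto simp: direct_sum_simps g_def quotient_simps[OF K] intro!: restrict_ext)
  have surj: "g ` carrier M = carrier ?D"
  proof
    show "g ` carrier M \<subseteq> carrier ?D"
      by (auto simp: direct_sum_simps g_def quotient_simps[OF K])
    show "carrier ?D \<subseteq> g ` carrier M"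
    proof
      fix f assume "f \<in> carrier ?D"
      then have f: "f \<in> extensional {..<n}" "\<forall>i<n. f i \<in> coset_of (K i) ` carrier M"
        by (auto simp: direct_sum_simps PiE_iff quotient_simps[OF K])
      then have "\<forall>i. \<exists>y. i < n \<longrightarrow> y \<in> carrier M \<and> f i = coset_of (K i) y" by blast
      then obtain y where y: "\<forall>i. i < n \<longrightarrow> y i \<in> carrier M \<and> f i = coset_of (K i) (y i)"
        by metis
      then obtain x where x: "x \<in> carrier M" "\<forall>i<n. coset_of (K i) x = coset_of (K i) (y i)"
        using coindependent_chinese_remainder[OF co, of y] by blast
      have "f = g x" using f y x by (auto simp: g_def extensional_def fun_eq_iff)
      then show "f \<in> g ` carrier M" using x by blast
    qed
  qed
  have "g x = \<zero>\<^bsub>?D\<^esub> \<longleftrightarrow> (\<forall>i<n. x \<in> K i)" if x: "x \<in> carrier M" for x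
  proof -
    have "coset_of (K i) x = coset_of (K i) \<zero>\<^bsub>M\<^esub> \<longleftrightarrow> x \<in> K i" if "i < n" for i
      using coset_of_eq_iff[OF K[OF that] x M.zero_closed] x by (simp add: diff_zero)
    then show ?thesis
      by (auto simp: g_def direct_sum_simps quotient_simps[OF K] fun_eq_iff restrict_def)
  qed
  then have ker: "a_kernel M ?D g = meet K {..<n}"
    by (auto simp: a_kernel_def kernel_def meet_def)
  have mK: "meet K {..<n} \<in> S" by (rule meet_submodule) (use K in auto)
  have "small_submodule R M (meet K {..<n})"
    unfolding small_submodule_def
  proof (intro conjI ballI impI notI)
    fix L assume L: "L \<in> S" "L \<noteq> carrier M" "meet K {..<n} <+>\<^bsub>M\<^esub> L = carrier M"
    then have "comaximal L (meet K {..<n})" using comaximal_sym mK by (simp add: comaximal_def)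
    then show False using small_overD[OF small] L submodule_zero by blast
  qed (rule mK)
  then have "hollow_cover R M n ?Q g"
    using hollow_module_quotient hq hom surj ker by (simp add: hollow_cover_def)
  then show ?thesis unfolding has_finite_hollow_dimension_def by blast
qed

section \<open>Additive rank functions and artinian orderings\<close>

lemma wf_cosplit_if_additive_rank:
  assumes d: "d \<in> S \<rightarrow> {0..n::nat}" "\<And>N. N \<in> S \<Longrightarrow> d N = 0 \<Longrightarrow> N = carrier M"
    "\<And>N L. N \<in> S \<Longrightarrow> L \<in> S \<Longrightarrow> comaximal N L \<Longrightarrow> d (N \<inter> L) = d N + d L"
  shows "wf cosplit"
proof (rule wf_subset)
  show "wf (measure (\<lambda>N. n - d N))" by simp
  have "n - d (A \<inter> L) < n - d A"
    if "A \<in> S" "L \<in> S" "comaximal A L" "L \<noteq> carrier M" for A L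
  proof -
    have "d (A \<inter> L) \<le> n" using d(1) submodule_Int that by fastforce
    moreover have "d L \<noteq> 0" using d(2) that by blast
    ultimately show ?thesis using d(3) that by simp
  qed
  then show "cosplit \<subseteq> measure (\<lambda>N. n - d N)" unfolding cosplit_def by force
qed

lemma wf_cosplit_if_artinian:
  assumes r: "artinian_poset S r"
    and dec: "\<And>N L. N \<in> S \<Longrightarrow> L \<in> S \<Longrightarrow> comaximal N L \<Longrightarrow> L \<noteq> carrier M
      \<Longrightarrow> (N \<inter> L, N) \<in> r \<and> N \<inter> L \<noteq> N"
  shows "wf cosplit"
  unfolding wf_iff_no_infinite_down_chain
proof
  assume "\<exists>f. \<forall>i. (f (Suc i), f i) \<in> cosplit"
  then obtain f where f: "\<And>i. (f (Suc i), f i) \<in> cosplit" by blast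
  have step: "f i \<in> S \<and> (f (Suc i), f i) \<in> r \<and> f (Suc i) \<noteq> f i" for i
  proof -
    obtain A L where "f (Suc i) = A \<inter> L" "f i = A" "A \<in> S" "L \<in> S" "comaximal A L"
      "L \<noteq> carrier M"
      using f[of i] by (auto simp: cosplit_def)
    then show ?thesis using dec by simp
  qed
  then have "(\<forall>i. f i \<in> S) \<and> (\<forall>i. (f (Suc i), f i) \<in> r)" by simp
  with r have "\<exists>k. \<forall>i\<ge>k. f i = f k"
    unfolding artinian_poset_def by (elim conjE allE[of _ f] impE) iprover+
  then obtain k where "\<forall>i\<ge>k. f i = f k" ..
  then have "f (Suc k) = f k" by (elim allE[of _ "Suc k"]) simp
  then show False using step by blast
qed

text \<open>
  Ordering submodules by reversed rank turns additivity into a strict descent, and boundedness of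
  the rank into the descending chain condition.
\<close>

lemma artinian_poset_rank_order:
  fixes d :: "'d set \<Rightarrow> nat"
  assumes bound: "\<And>N. N \<in> X \<Longrightarrow> d N \<le> n"
  shows "artinian_poset X {(K, N). K \<in> X \<and> N \<in> X \<and> (K = N \<or> d N < d K)}"
    (is "artinian_poset X ?r")
  unfolding artinian_poset_def
proof (intro conjI allI impI)
  show "partial_order_on X ?r"
    by (auto simp: partial_order_on_def preorder_on_def refl_on_def trans_def antisym_def)
next
  fix f :: "nat \<Rightarrow> 'd set"
  assume f: "(\<forall>i. f i \<in> X) \<and> (\<forall>i. (f (Suc i), f i) \<in> ?r)"
  have "\<exists>k. \<forall>i. n - d (f k) \<le> n - d (f i)"
    using ex_has_least_nat[of "\<lambda>_. True" 0 "\<lambda>i. n - d (f i)"] by blast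
  then obtain k where k: "\<And>i. n - d (f k) \<le> n - d (f i)" by blast
  have max: "d (f i) \<le> d (f k)" for i using k[of i] bound f by (metis diff_le_mono2 diff_diff_cancel)
  have "f (k + j) = f k" for j
  proof (induction j)
    case (Suc j)
    have "f (Suc (k + j)) = f (k + j) \<or> d (f (k + j)) < d (f (Suc (k + j)))" using f by blast
    then show ?case using Suc max[of "Suc (k + j)"] by auto
  qed simp
  then show "\<exists>k. \<forall>i\<ge>k. f i = f k" by (metis le_add_diff_inverse)
qed

lemma has_finite_hollow_dimension_iff_wf: "has_finite_hollow_dimension R M \<longleftrightarrow> wf cosplit"
proof
  assume "has_finite_hollow_dimension R M"
  then show "wf cosplit"
    unfolding has_finite_hollow_dimension_def
    using hollow_basis_if_hollow_cover wf_cosplit_if_hollow_basis by blast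
next
  assume "wf cosplit"
  moreover have "{\<zero>\<^bsub>M\<^esub>} \<in> S"
    using smult_r_distr[of _ "\<zero>\<^bsub>M\<^esub>" "\<zero>\<^bsub>M\<^esub>"] by (auto simp: submodule_iff M.add.r_cancel_one')
  ultimately show "has_finite_hollow_dimension R M"
    using ex_hollow_basis has_finite_hollow_dimension_if_hollow_basis by blast
qed

end

theorem theorem1p5:
  fixes R :: "('r, 's) ring_scheme" and M :: "('r, 'm, 't) module_scheme"
  assumes "left_module R M"
  shows
    "(has_finite_hollow_dimension R M \<longleftrightarrow>
      (\<exists>(n::nat) (d :: 'm set \<Rightarrow> nat).
        d \<in> submodules R M \<rightarrow> {0..n} \<and>
        (\<forall>N \<in> submodules R M. \<forall>L \<in> submodules R M.
          (d N = 0 \<longrightarrow> N = carrier M) \<and>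
          (N <+>\<^bsub>M\<^esub> L = carrier M \<longrightarrow> d (N \<inter> L) = d N + d L))))
    \<and> (has_finite_hollow_dimension R M \<longleftrightarrow>
      (\<exists>r :: 'm set rel.
        partial_order_on (submodules R M) r \<and>
        artinian_poset (submodules R M) r \<and>
        (\<forall>N \<in> submodules R M. \<forall>L \<in> submodules R M.
          N <+>\<^bsub>M\<^esub> L = carrier M \<longrightarrow> L \<noteq> carrier M \<longrightarrow>
            (N \<inter> L, N) \<in> r \<and> N \<inter> L \<noteq> N)))"
    (is "(?a \<longleftrightarrow> ?b) \<and> (?a \<longleftrightarrow> ?c)")
proof -
  interpret left_module R M by fact
  have ab: ?b if a: ?a
  proof -
    obtain n H where "hollow_basis {\<zero>\<^bsub>M\<^esub>} n H"
      using a[unfolded has_finite_hollow_dimension_def] hollow_basis_if_hollow_cover by blast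
    then obtain d where d: "d \<in> S \<rightarrow> {0..n}" "\<And>N. N \<in> S \<Longrightarrow> d N = 0 \<Longrightarrow> N = carrier M"
      "\<And>N L. N \<in> S \<Longrightarrow> L \<in> S \<Longrightarrow> comaximal N L \<Longrightarrow> d (N \<inter> L) = d N + d L"
      using ex_additive_rank by metis
    show ?b by (rule exI[of _ n], rule exI[of _ d]) (use d in \<open>auto simp: comaximal_def\<close>)
  qed
  have ba: ?a if ?b
    unfolding has_finite_hollow_dimension_iff_wf
    using that wf_cosplit_if_additive_rank unfolding comaximal_def by metis
  have bc: ?c if b: ?b
  proof -
    obtain n and d :: "'m set \<Rightarrow> nat" where d: "d \<in> S \<rightarrow> {0..n}"
      "\<And>N. N \<in> S \<Longrightarrow> d N = 0 \<Longrightarrow> N = carrier M"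
      "\<And>N L. N \<in> S \<Longrightarrow> L \<in> S \<Longrightarrow> N <+>\<^bsub>M\<^esub> L = carrier M \<Longrightarrow> d (N \<inter> L) = d N + d L"
      using b by metis
    let ?r = "{(K, N). K \<in> S \<and> N \<in> S \<and> (K = N \<or> d N < d K)}"
    have art: "artinian_poset S ?r" by (rule artinian_poset_rank_order[of S d n]) (use d in auto)
    have dec: "(N \<inter> L, N) \<in> ?r \<and> N \<inter> L \<noteq> N"
      if NL: "N \<in> S" "L \<in> S" "N <+>\<^bsub>M\<^esub> L = carrier M" "L \<noteq> carrier M" for N L
    proof -
      have "d N < d (N \<inter> L)" using d(2)[of L] d(3) NL by auto
      then show ?thesis using NL submodule_Int by auto
    qed
    have "partial_order_on S ?r" using art by (simp only: artinian_poset_def)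
    then show ?c
      by (intro exI[of _ ?r] conjI[OF _ conjI] art ballI impI dec)
  qed
  have ca: ?a if ?c
    unfolding has_finite_hollow_dimension_iff_wf
    using that wf_cosplit_if_artinian unfolding comaximal_def by metis
  show ?thesis by (rule conjI[OF iffI[OF ab ba] iffI[OF bc[OF ab] ca]])
qed

end
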